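(* Let $q_1(\cdot)\in \mathscr{C}^{\log}(\mathbb{R}^n)\cap\mathscr{P}(\mathbb{R}^n)$ satisfy $$1<q_1(\infty)\le q_1(x)\le (q_1)_+<\infty\qquad (x\in\mathbb{R}^n).$$ Let $\beta:\mathbb{R}^n\to[0,n)$ be a measurable function (not assumed continuous) such that $$\operatorname*{ess\,inf}_{x\in\mathbb{R}^n}\beta(x)>0,\qquad \operatorname*{ess\,sup}_{x\in\mathbb{R}^n}q_1(x)\beta(x)<n,\qquad \operatorname*{ess\,sup}_{x\in\mathbb{R}^n}q_1(\infty)\beta(x)<n.$$ Define the variable exponent $q_2(\cdot)$ by $$\frac1{q_2(x)}=\frac1{q_1(x)}-\frac{\beta(x)}{n}.$$ Let $C_\infty>0$ be a constant such that $|q_1(x)-q_1(\infty)|\le \frac{C_\infty}{\ln(e+|x|)}$ for all $x\in\mathbb{R}^n$, and set $$\gamma(x)=C_\infty\,\beta(x)\Big(1-\frac{\beta(x)}{n}\Big).$$ Let $\delta_2\in(0,1/(q_2)_+)$ be a constant for which there is $C_0>0$ with $$\frac{\|\chi_S\|_{L^{q_2(\cdot)}(\mathbb{R}^n)}}{\|\chi_B\|_{L^{q_2(\cdot)}(\mathbb{R}^n)}}\le C_0\Big(\frac{|S|}{|B|}\Big)^{\delta_2}$$ for all balls $B\subset\mathbb{R}^n$ and all measurable subsets $S\subset B$. Let $0<p_1\le p_2<\infty$, $\lambda\ge 0$ and $\alpha\in\mathbb{R}$ with $\alpha>\lambda-n\delta_2$. Then there is a constant $C>0$, independent of $f$, such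 that for every $f\in M\dot K^{\alpha,\lambda}_{p_1,q_1(\cdot)}(\mathbb{R}^n)$, $$\Big\|(1+|x|)^{-\gamma(x)}\mathscr{H}^{\ast}_{\beta(\cdot)}(f)\Big\|_{M\dot K^{\alpha,\lambda}_{p_2,q_2(\cdot)}(\mathbb{R}^n)}\le C\,\|f\|_{M\dot K^{\alpha,\lambda}_{p_1,q_1(\cdot)}(\mathbb{R}^n)}.$$
   Context: Operator: for a locally integrable function $f$ and measurable $\beta$ with $0\le\beta(x)<n$, the (adjoint-type) $n$-dimensional fractional Hardy-type operator of variable order $\beta(x)$ is $$\mathscr{H}^{\ast}_{\beta(\cdot)}(f)(x)=\int_{|t|\ge|x|}\frac{f(t)}{|t|^{n-\beta(x)}}\,dt,\qquad x\in\mathbb{R}^n\setminus\{0\}$$ (the exponent involves $\beta$ evaluated at $x$, not at $t$). Exponents: for a measurable function $q(\cdot)$ on $\mathbb{R}^n$, $q_-=\operatorname{ess\,inf}_{x\in\mathbb{R}^n} q(x)$ and $q_+=\operatorname{ess\,sup}_{x\in\mathbb{R}^n} q(x)$. $\mathscr{P}(\mathbb{R}^n)$ is the set of measurable $q(\cdot):\mathbb{R}^n\to(1,\infty)$ with $1<q_-\le q(x)\le q_+<\infty$ for $x\in\mathbb{R}^n$. $\mathscr{C}^{\log}(\mathbb{R}^n)$ is the set of functions $q(\cdot):\mathbb{R}^n\to(0,\infty)$ for which there are constants $C,C_\infty>0$ such that $$|q(x)-q(y)|\le\frac{-C}{\ln(|x-y|)}\ \text{ for } |x-y|\le 1/2,\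 x,y\in\mathbb{R}^n,\qquad |q(x)-q(\infty)|\le\frac{C_\infty}{\ln(e+|x|)}\ \text{ for } x\in\mathbb{R}^n,$$ where $q(\infty)=\lim_{|x|\to\infty}q(x)$. Variable Lebesgue spaces: for measurable $\Omega\subset\mathbb{R}^n$ with $|\Omega|>0$ and measurable $q(\cdot):\Omega\to[1,\infty)$, $L^{q(\cdot)}(\Omega)$ is the space of measurable $f$ with $\int_\Omega (|f(x)|/\eta)^{q(x)}dx<\infty$ for some $\eta>0$, with norm $\|f\|_{L^{q(\cdot)}(\Omega)}=\inf\{\eta>0:\int_\Omega(|f(x)|/\eta)^{q(x)}dx\le1\}$. $L^{q(\cdot)}_{\mathrm{loc}}(\Omega)$ is the set of measurable $f$ with $f\in L^{q(\cdot)}(\Omega_0)$ for all compact subsets $\Omega_0\subset\Omega$. Herz-Morrey spaces: let $B_k=\{x\in\mathbb{R}^n:|x|\le 2^k\}$, $A_k=B_k\setminus B_{k-1}$, $\chi_k=\chi_{A_k}$ for $k\in\mathbb{Z}$. For $\alpha\in\mathbb{R}$, $0\le\lambda<\infty$, $0<p<\infty$, $q(\cdot)\in\mathscr{P}(\mathbb{R}^n)$, the space $M\dot K^{\alpha,\lambda}_{p,q(\cdot)}(\mathbb{R}^n)$ consists of all $f\in L^{q(\cdot)}_{\mathrm{loc}}(\mathbb{R}^n\setminus\{0\})$ with $$\|f\|_{M\dot K^{\alpha,\lambda}_{p,q(\cdot)}(\mathbb{R}^n)}=\sup_{k_0\in\mathbb{Z}}2^{-k_0\lambda}\Big(\sum_{k=-\infty}^{k_0}2^{k\alpha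 p}\|f\chi_k\|^p_{L^{q(\cdot)}(\mathbb{R}^n)}\Big)^{1/p}<\infty.$$ Here $|S|$ denotes Lebesgue measure and $\chi_S$ the characteristic function of a measurable set $S\subset\mathbb{R}^n$. *)

theory Defs
  imports "HOL-Analysis.Analysis" "HOL-Probability.Essential_Supremum"
begin

text \<open>
  "Measurable" means Lebesgue measurable throughout. Norms are valued in \<^typ>\<open>ennreal\<close>, so that
  they are defined for every function and equal \<open>\<infinity>\<close> for functions of infinite norm.
\<close>

definition essinf ::
  "'a measure \<Rightarrow> ('a \<Rightarrow> ereal) \<Rightarrow> ereal" where
  "essinf M f = - esssup M (\<lambda>x. - f x)"

definition exp_minus :: "('a::euclidean_space \<Rightarrow> real) \<Rightarrow> ereal" where
  "exp_minus q = essinf lebesgue (\<lambda>x. ereal (q x))"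

definition exp_plus :: "('a::euclidean_space \<Rightarrow> real) \<Rightarrow> ereal" where
  "exp_plus q = esssup lebesgue (\<lambda>x. ereal (q x))"

definition exp_infty :: "('a::euclidean_space \<Rightarrow> real) \<Rightarrow> real" where
  "exp_infty q = Lim at_infinity q"

definition exponents :: "('a::euclidean_space \<Rightarrow> real) set" where
  "exponents = {q. q \<in> borel_measurable lebesgue \<and> (\<forall>x. 1 < q x) \<and>
     1 < exp_minus q \<and> (\<forall>x. exp_minus q \<le> ereal (q x) \<and> ereal (q x) \<le> exp_plus q) \<and>
     exp_plus q < \<infinity>}"

text \<open>
  In the local condition the case \<open>x = y\<close> carries no information: its left-hand side is 0 and,
  since \<open>ln 0 = 0\<close> and \<open>C / 0 = 0\<close>, so is its right-hand side.
\<close>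

definition log_Hoelder :: "('a::euclidean_space \<Rightarrow> real) set" where
  "log_Hoelder = {q. (\<forall>x. 0 < q x) \<and>
     (\<exists>C>0. \<forall>x y. norm (x - y) \<le> 1/2 \<longrightarrow> \<bar>q x - q y\<bar> \<le> - C / ln (norm (x - y))) \<and>
     (q \<longlongrightarrow> exp_infty q) at_infinity \<and>
     (\<exists>C>0. \<forall>x. \<bar>q x - exp_infty q\<bar> \<le> C / ln (exp 1 + norm x))}"

definition modular :: "'a::euclidean_space set \<Rightarrow> ('a \<Rightarrow> real) \<Rightarrow> ('a \<Rightarrow> real) \<Rightarrow> ennreal" where
  "modular \<Omega> q f = (\<integral>\<^sup>+x\<in>\<Omega>. ennreal (\<bar>f x\<bar> powr q x) \<partial>lebesgue)"

definition var_Lebesgue :: "'a::euclidean_space set \<Rightarrow> ('a \<Rightarrow> real) \<Rightarrow> ('a \<Rightarrow> real) set" where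
  "var_Lebesgue \<Omega> q =
     {f \<in> borel_measurable (lebesgue_on \<Omega>). \<exists>\<eta>>0. modular \<Omega> q (\<lambda>x. f x / \<eta>) < \<infinity>}"

definition var_Lebesgue_norm ::
  "'a::euclidean_space set \<Rightarrow> ('a \<Rightarrow> real) \<Rightarrow> ('a \<Rightarrow> real) \<Rightarrow> ennreal" where
  "var_Lebesgue_norm \<Omega> q f = Inf {ennreal \<eta> | \<eta>. 0 < \<eta> \<and> modular \<Omega> q (\<lambda>x. f x / \<eta>) \<le> 1}"

definition var_Lebesgue_loc :: "'a::euclidean_space set \<Rightarrow> ('a \<Rightarrow> real) \<Rightarrow> ('a \<Rightarrow> real) set" where
  "var_Lebesgue_loc \<Omega> q =
     {f \<in> borel_measurable (lebesgue_on \<Omega>). \<forall>K. compact K \<and> K \<subseteq> \<Omega> \<longrightarrow> f \<in> var_Lebesgue K q}"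

definition dyadic_ball :: "int \<Rightarrow> 'a::euclidean_space set" where
  "dyadic_ball k = {x. norm x \<le> 2 powr real_of_int k}"

definition dyadic_annulus :: "int \<Rightarrow> 'a::euclidean_space set" where
  "dyadic_annulus k = dyadic_ball k - dyadic_ball (k - 1)"

text \<open>Real powers on \<open>[0, \<infinity>]\<close>; only meant for exponents \<open>p > 0\<close>.\<close>

definition ennpowr :: "ennreal \<Rightarrow> real \<Rightarrow> ennreal" where
  "ennpowr a p = (if a = \<infinity> then \<infinity> else ennreal (enn2real a powr p))"

definition herz_morrey_norm ::
  "real \<Rightarrow> real \<Rightarrow> real \<Rightarrow> ('a::euclidean_space \<Rightarrow> real) \<Rightarrow> ('a \<Rightarrow> real) \<Rightarrow> ennreal" where
  "herz_morrey_norm \<alpha> lam p q f =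
     (SUP k0::int. ennreal (2 powr (- real_of_int k0 * lam)) *
        ennpowr (\<Sum>\<^sub>\<infinity>k\<in>{..k0}. ennreal (2 powr (real_of_int k * \<alpha> * p)) *
          ennpowr (var_Lebesgue_norm UNIV q (\<lambda>x. f x * indicator (dyadic_annulus k) x)) p) (1 / p))"

definition herz_morrey ::
  "real \<Rightarrow> real \<Rightarrow> real \<Rightarrow> ('a::euclidean_space \<Rightarrow> real) \<Rightarrow> ('a \<Rightarrow> real) set" where
  "herz_morrey \<alpha> lam p q =
     {f \<in> var_Lebesgue_loc (UNIV - {0}) q. herz_morrey_norm \<alpha> lam p q f < \<infinity>}"

definition hardy_adj_kernel ::
  "(real ^ 'n \<Rightarrow> real) \<Rightarrow> (real ^ 'n \<Rightarrow> real) \<Rightarrow> real ^ 'n \<Rightarrow> real ^ 'n \<Rightarrow> real" where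
  "hardy_adj_kernel \<beta> f x t = f t / norm t powr (real CARD('n) - \<beta> x)"

text \<open>
  As a Bochner integral, \<open>hardy_adj \<beta> f x\<close> is 0 by convention where the integrand is not
  absolutely integrable, so integrability has to be asserted separately.
\<close>

definition hardy_adj ::
  "(real ^ 'n \<Rightarrow> real) \<Rightarrow> (real ^ 'n \<Rightarrow> real) \<Rightarrow> real ^ 'n \<Rightarrow> real" where
  "hardy_adj \<beta> f x = (LINT t:{t. norm x \<le> norm t}|lebesgue. hardy_adj_kernel \<beta> f x t)"

end

theory Submission
  imports Defs
begin

text \<open>
  Write \<open>n\<close> for the dimension. The boundedness of the operator comes from one pointwise estimate of
  its kernel, after which everything reduces to a Hardy inequality for sequences.

  For \<open>|x| \<le> |t|\<close>, the relation \<open>\<beta>(x) / n = 1 / q\<^sub>1(x) - 1 / q\<^sub>2(x)\<close> gives the factorisation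
  \<open>|t| powr (\<beta>(x) - n) = |t| powr (n / q\<^sub>1(t) - n) * |t| powr (- n / q\<^sub>2(x)) * |t| powr (n (1 / q\<^sub>1(x) - 1 / q\<^sub>1(t)))\<close>.
  The last factor is bounded, by the log-Hoelder condition near the origin and by \<open>q\<^sub>1(\<infinity>) \<le> q\<^sub>1(x)\<close>
  together with the decay condition away from it (\<open>log_Hoelder_norm_powr_bounded\<close>). Since
  \<open>\<delta>\<^sub>2 \<le> 1 / q\<^sub>2(x)\<close> almost everywhere, the middle factor is at most
  \<open>|x| powr (- n / q\<^sub>2(x)) * (|x| / |t|) powr (n \<delta>\<^sub>2)\<close>. The first factor is the critical weight dual to
  \<open>q\<^sub>1\<close>: its integral against \<open>|f|\<close> over a dyadic annulus is bounded by the norm of \<open>f\<close> there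
  (\<open>nn_integral_annulus_le_var_Lebesgue_norm\<close>). Summing over the annuli outside \<open>|x|\<close> therefore
  bounds the operator applied to \<open>f\<close>, at a point \<open>x\<close> of the \<open>k\<close>-th annulus, by a constant times
  \<open>|x| powr (- n / q\<^sub>2(x)) * T k\<close> with \<open>T k = (\<Sum>i. 2 powr (- i n \<delta>\<^sub>2) * \<nu> (k + i))\<close>, where \<open>\<nu> j\<close> is the norm of \<open>f\<close> on the
  \<open>j\<close>-th annulus (\<open>nn_integral_hardy_adj_kernel_le\<close>). In particular the defining integral converges
  absolutely.

  The function \<open>|x| powr (- n / q\<^sub>2(x))\<close> has bounded norm in \<open>L\<^sup>q\<^sup>2\<close> of every dyadic annulus, however
  irregular \<open>q\<^sub>2\<close> is (\<open>var_Lebesgue_norm_annulus_le\<close>), and the weight \<open>(1 + |x|) powr (- \<gamma>(x))\<close> is at most 1. So the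
  norm of the image on the \<open>k\<close>-th annulus is at most a constant times \<open>T k\<close>. It remains to bound
  \<open>T\<close> by \<open>\<nu>\<close> in the sequence norm that defines the Herz-Morrey space. This is a discrete Hardy
  inequality with decay rate \<open>n \<delta>\<^sub>2 + \<alpha>\<close>, which exceeds \<open>lam\<close> by hypothesis
  (\<open>discrete_hardy_morrey\<close>).
\<close>

section \<open>Sums and powers in the extended nonnegative reals\<close>

lemma sum_le_infsum_ennreal:
  fixes f :: "'a \<Rightarrow> ennreal"
  assumes "finite F" "F \<subseteq> A"
  shows "sum f F \<le> infsum f A"
  using assms by (subst nonneg_infsum_complete) (auto intro!: SUP_upper)

lemma infsum_ennreal_le:
  fixes f :: "'a \<Rightarrow> ennreal"
  assumes "\<And>F. finite F \<Longrightarrow> F \<subseteq> A \<Longrightarrow> sum f F \<le> c"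
  shows "infsum f A \<le> c"
  using assms by (subst nonneg_infsum_complete) (auto intro!: SUP_least)

lemma ennpowr_top [simp]: "ennpowr top p = top"
  by (simp add: ennpowr_def)

lemma ennpowr_ennreal [simp]: "0 \<le> x \<Longrightarrow> ennpowr (ennreal x) p = ennreal (x powr p)"
  by (simp add: ennpowr_def)

lemma ennpowr_mono:
  assumes "a \<le> b" "0 \<le> p"
  shows "ennpowr a p \<le> ennpowr b p"
proof (cases b)
  case (real y)
  then have "a \<noteq> \<infinity>" using assms by (auto simp: top_unique)
  then obtain x where x: "0 \<le> x" "a = ennreal x" by (cases a) auto
  then have "x \<le> y" using assms real by simp
  then show ?thesis using x real assms by (simp add: powr_mono2 ennreal_leI)
next
  case top
  then show ?thesis by (simp add: ennpowr_def)
qed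

text \<open>
  This moves the outer exponent \<open>1 / p\<close> of the Herz-Morrey norm to the other side, so that the norm
  can be read as a bound on sums of \<open>p\<close>-th powers.
\<close>

lemma ennpowr_inverse_le_iff:
  assumes "0 < p" "0 \<le> c"
  shows "ennpowr a (1 / p) \<le> ennreal c \<longleftrightarrow> a \<le> ennreal (c powr p)"
proof (cases a)
  case (real x)
  have "x powr (1 / p) \<le> c \<longleftrightarrow> x \<le> c powr p"
  proof
    assume "x powr (1 / p) \<le> c"
    then have "(x powr (1 / p)) powr p \<le> c powr p" using assms by (intro powr_mono2) auto
    then show "x \<le> c powr p" using assms real by (simp add: powr_powr)
  next
    assume "x \<le> c powr p"
    then have "x powr (1 / p) \<le> (c powr p) powr (1 / p)" using assms real by (intro powr_mono2) auto
    then show "x powr (1 / p) \<le> c" using assms by (simp add: powr_powr)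
  qed
  then show ?thesis using real assms by simp
next
  case top
  then show ?thesis using assms by (simp add: ennpowr_def top_unique)
qed

section \<open>Herz-Morrey norms as families of finite sums\<close>

lemma herz_morrey_norm_le_iff_infsum:
  assumes "0 < p" "0 \<le> M"
  shows "herz_morrey_norm \<alpha> lam p q f \<le> ennreal M \<longleftrightarrow>
    (\<forall>m. (\<Sum>\<^sub>\<infinity>k\<in>{..m}. ennreal (2 powr (real_of_int k * \<alpha> * p)) *
          ennpowr (var_Lebesgue_norm UNIV q (\<lambda>x. f x * indicator (dyadic_annulus k) x)) p)
       \<le> ennreal ((M * 2 powr (real_of_int m * lam)) powr p))"
proof -
  have *: "ennreal (2 powr (- real_of_int m * lam)) * b \<le> ennreal M \<longleftrightarrow>
      b \<le> ennreal (M * 2 powr (real_of_int m * lam))" (is "?l * b \<le> _ \<longleftrightarrow> _") for b and m :: int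
  proof -
    have inv: "2 powr (- real_of_int m * lam) * 2 powr (real_of_int m * lam) = (1::real)"
      by (simp flip: powr_add)
    have "?l * b \<le> ennreal M \<longleftrightarrow> ?l * b \<le> ?l * ennreal (M * 2 powr (real_of_int m * lam))"
      using inv assms by (simp add: mult.left_commute flip: ennreal_mult)
    also have "\<dots> \<longleftrightarrow> b \<le> ennreal (M * 2 powr (real_of_int m * lam))"
      by (subst ennreal_mult_le_mult_iff) auto
    finally show ?thesis .
  qed
  show ?thesis
    unfolding herz_morrey_norm_def SUP_le_iff *
    using assms by (simp add: ennpowr_inverse_le_iff)
qed

text \<open>
  The next two lemmas trade a bound on the norm for a family of inequalities between finite sums of
  real numbers; all estimates for sequences can then be made in \<^typ>\<open>real\<close>, where series are easier
  to handle than unordered sums in \<^typ>\<open>ennreal\<close>.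
\<close>

lemma herz_morrey_norm_leD:
  assumes p: "0 < p" and M: "0 \<le> M" and le: "herz_morrey_norm \<alpha> lam p q f \<le> ennreal M"
  defines "N \<equiv> \<lambda>k. var_Lebesgue_norm UNIV q (\<lambda>x. f x * indicator (dyadic_annulus k) x)"
  shows "N k < \<infinity>"
    and "finite F \<Longrightarrow> F \<subseteq> {..m} \<Longrightarrow>
      (\<Sum>k\<in>F. (2 powr (real_of_int k * \<alpha>) * enn2real (N k)) powr p)
        \<le> (M * 2 powr (real_of_int m * lam)) powr p"
proof -
  define t where "t k = ennreal (2 powr (real_of_int k * \<alpha> * p)) * ennpowr (N k) p" for k
  have sums: "sum t F \<le> ennreal ((M * 2 powr (real_of_int m * lam)) powr p)"
    if "finite F" "F \<subseteq> {..m}" for F m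
  proof -
    have "sum t F \<le> infsum t {..m}" using that by (rule sum_le_infsum_ennreal)
    also have "\<dots> \<le> ennreal ((M * 2 powr (real_of_int m * lam)) powr p)"
      using le unfolding herz_morrey_norm_le_iff_infsum[OF p M] t_def N_def by blast
    finally show ?thesis .
  qed
  show fin: "N k < \<infinity>" for k
  proof (rule ccontr)
    assume "\<not> N k < \<infinity>"
    then have "N k = \<infinity>" by (simp flip: less_top)
    then have "t k = \<infinity>" by (simp add: t_def ennreal_mult_top)
    moreover have "t k \<le> ennreal ((M * 2 powr (real_of_int k * lam)) powr p)"
      using sums[of "{k}" k] by simp
    ultimately show False by (simp add: top_unique)
  qed
  have t: "t k = ennreal ((2 powr (real_of_int k * \<alpha>) * enn2real (N k)) powr p)" for k
    using fin[of k] by (cases "N k") (auto simp: t_def powr_mult powr_powr simp flip: ennreal_mult)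
  show "(\<Sum>k\<in>F. (2 powr (real_of_int k * \<alpha>) * enn2real (N k)) powr p)
        \<le> (M * 2 powr (real_of_int m * lam)) powr p" if "finite F" "F \<subseteq> {..m}"
    using sums[OF that] by (simp add: t sum_ennreal)
qed

lemma herz_morrey_norm_leI:
  assumes p: "0 < p" and M: "0 \<le> M" and b: "\<And>k. 0 \<le> b k"
    and N: "\<And>k. var_Lebesgue_norm UNIV q (\<lambda>x. f x * indicator (dyadic_annulus k) x) \<le> ennreal (b k)"
    and sums: "\<And>F m. finite F \<Longrightarrow> F \<subseteq> {..m} \<Longrightarrow>
      (\<Sum>k\<in>F. (2 powr (real_of_int k * \<alpha>) * b k) powr p) \<le> (M * 2 powr (real_of_int m * lam)) powr p"
  shows "herz_morrey_norm \<alpha> lam p q f \<le> ennreal M"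
  unfolding herz_morrey_norm_le_iff_infsum[OF p M]
proof (intro allI infsum_ennreal_le)
  fix m and F :: "int set" assume F: "finite F" "F \<subseteq> {..m}"
  have "(\<Sum>k\<in>F. ennreal (2 powr (real_of_int k * \<alpha> * p)) *
          ennpowr (var_Lebesgue_norm UNIV q (\<lambda>x. f x * indicator (dyadic_annulus k) x)) p)
      \<le> (\<Sum>k\<in>F. ennreal (2 powr (real_of_int k * \<alpha> * p)) * ennpowr (ennreal (b k)) p)"
    using N p by (intro sum_mono mult_left_mono ennpowr_mono) auto
  also have "\<dots> = ennreal (\<Sum>k\<in>F. (2 powr (real_of_int k * \<alpha>) * b k) powr p)"
    using b by (subst sum_ennreal[symmetric])
      (auto intro!: sum.cong simp: powr_mult powr_powr simp flip: ennreal_mult)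
  also have "\<dots> \<le> ennreal ((M * 2 powr (real_of_int m * lam)) powr p)"
    using sums[OF F] by (rule ennreal_leI)
  finally show "(\<Sum>k\<in>F. ennreal (2 powr (real_of_int k * \<alpha> * p)) *
          ennpowr (var_Lebesgue_norm UNIV q (\<lambda>x. f x * indicator (dyadic_annulus k) x)) p)
      \<le> ennreal ((M * 2 powr (real_of_int m * lam)) powr p)" .
qed

section \<open>A discrete Hardy inequality with Morrey control\<close>

text \<open>
  The embedding of \<open>\<ell>\<^sup>p\<close> into \<open>\<ell>\<^sup>r\<close>: no term exceeds \<open>B\<close>, so \<open>r - p\<close> of the \<open>r\<close> factors of each term can
  be replaced by \<open>B\<close>.
\<close>

lemma sum_powr_le_powr_mono:
  fixes c :: "'i \<Rightarrow> real"
  assumes F: "finite F" and c: "\<And>k. k \<in> F \<Longrightarrow> 0 \<le> c k" and p: "0 < p" "p \<le> r" and B: "0 \<le> B"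
    and sum: "(\<Sum>k\<in>F. c k powr p) \<le> B powr p"
  shows "(\<Sum>k\<in>F. c k powr r) \<le> B powr r"
proof -
  have le: "c k \<le> B" if "k \<in> F" for k
  proof -
    have "c k powr p \<le> (\<Sum>k\<in>F. c k powr p)" using F that by (intro member_le_sum) auto
    then have "c k powr p \<le> B powr p" using sum by simp
    then show ?thesis using p B by (metis not_le powr_less_mono2)
  qed
  have "c k powr r \<le> c k powr p * B powr (r - p)" if "k \<in> F" for k
  proof -
    have "c k powr r = c k powr p * c k powr (r - p)" by (simp flip: powr_add)
    also have "\<dots> \<le> c k powr p * B powr (r - p)"
      using le[OF that] c[OF that] p by (intro mult_left_mono powr_mono2) auto
    finally show ?thesis .
  qed
  then have "(\<Sum>k\<in>F. c k powr r) \<le> (\<Sum>k\<in>F. c k powr p) * B powr (r - p)"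
    by (simp add: sum_distrib_right sum_mono)
  also have "\<dots> \<le> B powr p * B powr (r - p)" using sum by (intro mult_right_mono) auto
  also have "\<dots> = B powr r" by (simp flip: powr_add)
  finally show ?thesis .
qed

text \<open>
  Write \<open>c\<^sub>k = (\<Sum>i. 2\<^sup>-\<^sup>i\<^sup>s a\<^sub>k\<^sub>+\<^sub>i)\<close>. Half of the surplus \<open>s - lam\<close> is spent on a geometric factor:
  \<open>c\<^sub>k = (\<Sum>i. \<rho>\<^sup>i u\<^sub>i)\<close> with \<open>u\<^sub>i = 2\<^sup>-\<^sup>i\<^sup>s\<^sup>' a\<^sub>k\<^sub>+\<^sub>i\<close> and \<open>s' = (s + lam) / 2\<close>. Every \<open>u\<^sub>i\<close> is at most \<open>G\<^sub>k\<^sup>1\<^sup>/\<^sup>p\<close> where \<open>G\<^sub>k = (\<Sum>i. u\<^sub>i\<^sup>p)\<close>, hence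
  \<open>c\<^sub>k\<^sup>p\<close> is bounded by a multiple of \<open>G\<^sub>k\<close>; this replaces both the \<open>p\<close>-triangle inequality and
  Hoelder's inequality, for \<open>p < 1\<close> and \<open>p \<ge> 1\<close> alike. Summing \<open>G\<^sub>k\<close> over
  \<open>k \<le> m\<close>, the \<open>i\<close>-th layer only involves \<open>a\<^sub>j\<close> with \<open>j \<le> m + i\<close>. The Morrey bound at level \<open>m + i\<close>
  loses \<open>2 powr (i lam)\<close>, and the other half of the surplus makes the layers summable. The constant does
  not depend on \<open>a\<close> and \<open>M\<close>.
\<close>

lemma discrete_hardy_morrey:
  fixes p r s lam :: real
  assumes p: "0 < p" "p \<le> r" and s: "lam < s"
  shows "\<exists>D>0. \<forall>(a :: int \<Rightarrow> real) M. 0 \<le> M \<longrightarrow> (\<forall>k. 0 \<le> a k) \<longrightarrow>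
     (\<forall>m F. finite F \<longrightarrow> F \<subseteq> {..m} \<longrightarrow>
        (\<Sum>k\<in>F. a k powr p) \<le> (M * 2 powr (real_of_int m * lam)) powr p) \<longrightarrow>
     (\<forall>k. summable (\<lambda>i. 2 powr (- real i * s) * a (k + int i))) \<and>
     (\<forall>m F. finite F \<longrightarrow> F \<subseteq> {..m} \<longrightarrow>
        (\<Sum>k\<in>F. (\<Sum>i. 2 powr (- real i * s) * a (k + int i)) powr r)
          \<le> (D * M * 2 powr (real_of_int m * lam)) powr r)"
proof -
  define \<rho> :: real where "\<rho> = 2 powr (- (s - lam) / 2)"
  define s' where "s' = (s + lam) / 2"
  have rho: "0 < \<rho>" "\<rho> < 1" using s by (auto simp: \<rho>_def intro!: powr_less_one)
  have rho_powr: "0 < \<rho> powr p" "\<rho> powr p < 1"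
    using rho p powr_less_mono2[of p \<rho> 1] by auto
  have rho_pow: "\<rho> ^ i = 2 powr (- real i * (s - lam) / 2)" for i
    using rho by (simp add: \<rho>_def powr_powr powr_realpow[symmetric] field_simps)
  have split_s: "2 powr (- real i * s) = \<rho> ^ i * 2 powr (- real i * s')" for i
    by (simp add: rho_pow s'_def field_simps flip: powr_add)
  have split_lam: "2 powr (- real i * s') * 2 powr (real i * lam) = \<rho> ^ i" for i
    by (simp add: rho_pow s'_def field_simps flip: powr_add)
  define D where "D = 1 / (1 - \<rho>) * (1 / (1 - \<rho> powr p)) powr (1 / p)"
  have "D > 0" using rho rho_powr unfolding D_def by (intro mult_pos_pos) (auto simp: powr_gt_zero)
  show ?thesis
  proof (intro exI[of _ D] conjI allI impI)
    show "D > 0" by fact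
    fix a :: "int \<Rightarrow> real" and M :: real
    assume M: "0 \<le> M" and "\<forall>k. 0 \<le> a k"
      and "\<forall>m F. finite F \<longrightarrow> F \<subseteq> {..m} \<longrightarrow>
        (\<Sum>k\<in>F. a k powr p) \<le> (M * 2 powr (real_of_int m * lam)) powr p"
    then have a: "\<And>k. 0 \<le> a k" and sums: "\<And>m F. finite F \<Longrightarrow> F \<subseteq> {..m} \<Longrightarrow>
        (\<Sum>k\<in>F. a k powr p) \<le> (M * 2 powr (real_of_int m * lam)) powr p" by auto
    define u where "u k i = 2 powr (- real i * s') * a (k + int i)" for k i
    have u_nonneg: "0 \<le> u k i" for k i using a by (simp add: u_def)
    \<comment> \<open>The translate of \<open>F\<close> by \<open>i\<close> lies in \<open>{..m + i}\<close>, where the hypothesis applies.\<close>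
    have u_sums: "(\<Sum>k\<in>F. u k i powr p) \<le> (M * 2 powr (real_of_int m * lam)) powr p * (\<rho> powr p) ^ i"
      if F: "finite F" "F \<subseteq> {..m}" for F m i
    proof -
      have "(\<Sum>k\<in>F. u k i powr p) = (2 powr (- real i * s')) powr p * (\<Sum>k\<in>F. a (k + int i) powr p)"
        using a by (simp add: u_def powr_mult sum_distrib_left)
      also have "(\<Sum>k\<in>F. a (k + int i) powr p) = (\<Sum>k\<in>(\<lambda>k. k + int i) ` F. a k powr p)"
        by (subst sum.reindex) (auto simp: inj_on_def)
      also have "\<dots> \<le> (M * 2 powr (real_of_int (m + int i) * lam)) powr p"
        using F by (intro sums) auto
      also have "(2 powr (- real i * s')) powr p * \<dots> =
         (M * 2 powr (real_of_int m * lam) * (2 powr (- real i * s') * 2 powr (real i * lam))) powr p"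
        using M by (simp add: powr_mult[symmetric] distrib_right distrib_left powr_add mult_ac)
      also have "\<dots> = (M * 2 powr (real_of_int m * lam)) powr p * (\<rho> powr p) ^ i"
      proof -
        have "(\<rho> ^ i) powr p = (\<rho> powr p) ^ i"
          using rho by (simp add: powr_realpow[symmetric] powr_powr mult.commute)
        then show ?thesis using M rho by (subst split_lam) (simp add: powr_mult)
      qed
      finally show ?thesis by (simp add: mult_left_mono)
    qed
    have geo: "summable (\<lambda>i. c * (\<rho> powr p) ^ i)" "(\<Sum>i. c * (\<rho> powr p) ^ i) = c / (1 - \<rho> powr p)"
      for c :: real
      using rho_powr by (auto intro!: summable_mult summable_geometric simp: suminf_mult suminf_geometric)
    have sG: "summable (\<lambda>i. u k i powr p)" for k
      using u_sums[of "{k}" k] by (intro summable_comparison_test'[OF geo(1)]) auto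
    define G where "G k = (\<Sum>i. u k i powr p)" for k
    have G_nonneg: "0 \<le> G k" for k by (auto simp: G_def intro!: suminf_nonneg sG)
    have u_le: "u k i \<le> G k powr (1 / p)" for k i
    proof -
      have "u k i powr p \<le> G k" unfolding G_def
        using sum_le_suminf[OF sG, of "{i}" k] by simp
      then have "(u k i powr p) powr (1 / p) \<le> G k powr (1 / p)" using p by (intro powr_mono2) auto
      then show ?thesis using p u_nonneg by (simp add: powr_powr)
    qed
    have c_eq: "2 powr (- real i * s) * a (k + int i) = \<rho> ^ i * u k i" for k i
      by (simp only: split_s u_def mult.assoc)
    have sgeo: "summable (\<lambda>i. \<rho> ^ i * c)" for c
      using rho by (intro summable_mult2 summable_geometric) auto
    have c_le: "\<rho> ^ i * u k i \<le> \<rho> ^ i * G k powr (1 / p)" for k i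
      using rho u_le by (intro mult_left_mono) auto
    have sc: "summable (\<lambda>i. \<rho> ^ i * u k i)" for k
      using c_le u_nonneg rho by (intro summable_comparison_test'[OF sgeo[of "G k powr (1 / p)"]]) auto
    show "summable (\<lambda>i. 2 powr (- real i * s) * a (k + int i))" for k
      using sc unfolding c_eq .
    have c_nonneg: "0 \<le> (\<Sum>i. \<rho> ^ i * u k i)" for k
      using rho u_nonneg by (intro suminf_nonneg sc) auto
    have c_powr: "(\<Sum>i. \<rho> ^ i * u k i) powr p \<le> (1 / (1 - \<rho>)) powr p * G k" for k
    proof -
      have "(\<Sum>i. \<rho> ^ i * u k i) \<le> (\<Sum>i. \<rho> ^ i * G k powr (1 / p))"
        by (intro suminf_le c_le sc sgeo)
      also have "\<dots> = 1 / (1 - \<rho>) * G k powr (1 / p)"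
        using rho by (subst suminf_mult2[symmetric]) (auto simp: suminf_geometric intro: summable_geometric)
      finally have "(\<Sum>i. \<rho> ^ i * u k i) powr p \<le> (1 / (1 - \<rho>) * G k powr (1 / p)) powr p"
        using p c_nonneg by (intro powr_mono2) auto
      also have "\<dots> = (1 / (1 - \<rho>)) powr p * G k"
        using rho p G_nonneg[of k] by (subst powr_mult) (auto simp: powr_powr)
      finally show ?thesis .
    qed
    fix m and F :: "int set" assume F: "finite F" "F \<subseteq> {..m}"
    define X where "X = M * 2 powr (real_of_int m * lam)"
    have "0 \<le> X" using M by (simp add: X_def)
    have "(\<Sum>k\<in>F. G k) = (\<Sum>i. \<Sum>k\<in>F. u k i powr p)"
      unfolding G_def using sG by (subst suminf_sum) auto
    also have "\<dots> \<le> (\<Sum>i. X powr p * (\<rho> powr p) ^ i)"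
      unfolding X_def by (intro suminf_le u_sums F summable_sum sG geo(1))
    also have "\<dots> = X powr p / (1 - \<rho> powr p)" by (rule geo(2))
    finally have sumG: "(\<Sum>k\<in>F. G k) \<le> X powr p / (1 - \<rho> powr p)" .
    have "(\<Sum>k\<in>F. (\<Sum>i. \<rho> ^ i * u k i) powr p) \<le> (\<Sum>k\<in>F. (1 / (1 - \<rho>)) powr p * G k)"
      by (intro sum_mono c_powr)
    also have "\<dots> \<le> (1 / (1 - \<rho>)) powr p * (X powr p / (1 - \<rho> powr p))"
      using sumG by (subst sum_distrib_left[symmetric]) (intro mult_left_mono, auto)
    also have "\<dots> = (D * X) powr p"
      using rho rho_powr p \<open>0 \<le> X\<close> by (simp add: D_def powr_mult powr_powr powr_divide)
    finally have sum_p: "(\<Sum>k\<in>F. (\<Sum>i. \<rho> ^ i * u k i) powr p) \<le> (D * X) powr p" .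
    have "0 \<le> D * X" using \<open>0 < D\<close> \<open>0 \<le> X\<close> by simp
    then have "(\<Sum>k\<in>F. (\<Sum>i. \<rho> ^ i * u k i) powr r) \<le> (D * X) powr r"
      by (rule sum_powr_le_powr_mono[OF F(1) c_nonneg p _ sum_p])
    then show "(\<Sum>k\<in>F. (\<Sum>i. 2 powr (- real i * s) * a (k + int i)) powr r)
          \<le> (D * M * 2 powr (real_of_int m * lam)) powr r"
      by (simp only: c_eq X_def mult.assoc)
  qed
qed

section \<open>Variable exponents on dyadic annuli\<close>

lemma dyadic_annulus_iff:
  "x \<in> dyadic_annulus k \<longleftrightarrow> 2 powr (real_of_int k - 1) < norm x \<and> norm x \<le> 2 powr real_of_int k"
  by (auto simp: dyadic_annulus_def dyadic_ball_def)

lemma dyadic_annulus_nonzero: "x \<in> dyadic_annulus k \<Longrightarrow> x \<noteq> 0"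
  using powr_ge_zero[of 2 "real_of_int k - 1"] by (auto simp: dyadic_annulus_iff)

lemma mem_dyadic_annulus_ceiling:
  assumes "x \<noteq> 0"
  shows "x \<in> dyadic_annulus \<lceil>log 2 (norm x)\<rceil>"
proof -
  have x: "norm x = 2 powr log 2 (norm x)" using assms by simp
  have "2 powr (real_of_int \<lceil>log 2 (norm x)\<rceil> - 1) < 2 powr log 2 (norm x)"
    "2 powr log 2 (norm x) \<le> 2 powr real_of_int \<lceil>log 2 (norm x)\<rceil>"
    by (simp_all add: ceiling_correct)
  then show ?thesis using x by (simp add: dyadic_annulus_iff)
qed

lemma dyadic_annulus_sets [measurable, simp]:
  "dyadic_annulus k \<in> sets (borel :: 'a::euclidean_space measure)"
proof -
  have "closed (dyadic_ball k :: 'a set)" for k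
    unfolding dyadic_ball_def by (intro closed_Collect_le continuous_intros)
  then show ?thesis unfolding dyadic_annulus_def by (intro sets.Diff borel_closed)
qed

lemma dyadic_annulus_sets_lebesgue [measurable, simp]:
  "dyadic_annulus k \<in> sets (lebesgue :: 'a::euclidean_space measure)"
  by (intro sets_completionI_sets) simp

lemma borel_measurable_norm_lebesgue [measurable]:
  "(norm :: 'a::euclidean_space \<Rightarrow> real) \<in> borel_measurable lebesgue"
  by (rule measurable_completion) simp

lemma outside_ball_subset_annuli:
  fixes x :: "'a::euclidean_space"
  assumes "x \<in> dyadic_annulus k"
  shows "{t::'a. norm x \<le> norm t} \<subseteq> (\<Union>i. dyadic_annulus (k + int i))"
proof
  fix t :: 'a assume "t \<in> {t::'a. norm x \<le> norm t}"
  then have le: "norm x \<le> norm t" by simp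
  moreover have "x \<noteq> 0" using assms by (rule dyadic_annulus_nonzero)
  ultimately have "t \<noteq> 0" by auto
  define j where "j = \<lceil>log 2 (norm t)\<rceil>"
  have t: "t \<in> dyadic_annulus j" unfolding j_def using \<open>t \<noteq> 0\<close> by (rule mem_dyadic_annulus_ceiling)
  have "2 powr (real_of_int k - 1) < 2 powr real_of_int j"
    using assms t le unfolding dyadic_annulus_iff by linarith
  then have "k \<le> j" by simp
  then have "t \<in> dyadic_annulus (k + int (nat (j - k)))" using t by simp
  then show "t \<in> (\<Union>i. dyadic_annulus (k + int i))" by blast
qed

text \<open>
  One more than the volume of a ball of radius 2, which bounds the integral of \<open>|x|\<^sup>-\<^sup>n\<close> over any
  dyadic annulus (the annulus has outer radius \<open>2\<^sup>k\<close>, and \<open>|x| \<ge> 2\<^sup>k\<^sup>-\<^sup>1\<close> on it). The added 1 is room for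
  a modular that is at most 1, and makes the constant at least 1.
\<close>

definition annulus_const :: "nat \<Rightarrow> real" where
  "annulus_const n = unit_ball_vol (real n) * 2 ^ n + 1"

lemma annulus_const_ge_1: "1 \<le> annulus_const n"
  by (simp add: annulus_const_def)

lemma nn_integral_annulus_norm_powr_le:
  "(\<integral>\<^sup>+x\<in>(dyadic_annulus k :: 'a::euclidean_space set). ennreal (norm x powr - real DIM('a)) \<partial>lebesgue)
     \<le> ennreal (annulus_const DIM('a) - 1)"
proof -
  let ?n = "real DIM('a)"
  let ?c = "2 powr ((1 - real_of_int k) * ?n)"
  have "(\<integral>\<^sup>+x\<in>(dyadic_annulus k :: 'a set). ennreal (norm x powr - ?n) \<partial>lebesgue)
     \<le> (\<integral>\<^sup>+(x::'a). ennreal ?c * indicator (dyadic_annulus k) x \<partial>lebesgue)"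
  proof (intro nn_integral_mono)
    fix x :: 'a
    have "norm x powr - ?n \<le> ?c" if "x \<in> dyadic_annulus k"
    proof -
      have "norm x powr - ?n \<le> (2 powr (real_of_int k - 1)) powr - ?n"
        using that by (intro powr_mono2') (auto simp: dyadic_annulus_iff)
      also have "\<dots> = ?c" by (simp add: powr_powr algebra_simps)
      finally show ?thesis .
    qed
    then show "ennreal (norm x powr - ?n) * indicator (dyadic_annulus k) x
        \<le> ennreal ?c * indicator (dyadic_annulus k) x"
      by (auto simp: indicator_def intro: ennreal_leI)
  qed
  also have "\<dots> = ennreal ?c * emeasure lebesgue (dyadic_annulus k :: 'a set)"
    by (subst nn_integral_cmult_indicator) auto
  also have "\<dots> \<le> ennreal ?c * emeasure lebesgue (cball 0 (2 powr real_of_int k) :: 'a set)"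
    by (intro mult_left_mono emeasure_mono) (auto simp: dyadic_annulus_iff)
  also have "\<dots> = ennreal ?c * ennreal (unit_ball_vol ?n * (2 powr real_of_int k) ^ DIM('a))"
    by (simp add: emeasure_cball)
  also have "\<dots> = ennreal (unit_ball_vol ?n * (?c * 2 powr (real_of_int k * ?n)))"
    by (simp add: powr_power mult_ac flip: ennreal_mult)
  also have "?c * 2 powr (real_of_int k * ?n) = 2 ^ DIM('a)"
    by (simp add: algebra_simps powr_realpow flip: powr_add)
  finally show ?thesis by (simp add: annulus_const_def)
qed

text \<open>
  The function \<open>|x|\<^sup>-\<^sup>n\<^sup>/\<^sup>q\<^sup>(\<^sup>x\<^sup>)\<close> is critical for the exponent \<open>q\<close>: its \<open>q(x)\<close>-th power is \<open>|x|\<^sup>-\<^sup>n\<close>, whose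
  integral over a dyadic annulus is bounded independently of the annulus. So a pointwise bound by
  that function controls the norm.
\<close>

lemma var_Lebesgue_norm_annulus_le:
  fixes q g :: "'a::euclidean_space \<Rightarrow> real"
  assumes q: "AE x in lebesgue. 1 \<le> q x" and \<tau>: "0 \<le> \<tau>"
    and g: "AE x in lebesgue. x \<in> dyadic_annulus k \<longrightarrow> \<bar>g x\<bar> \<le> \<tau> * norm x powr (- real DIM('a) / q x)"
  shows "var_Lebesgue_norm UNIV q (\<lambda>x. g x * indicator (dyadic_annulus k) x)
           \<le> ennreal (annulus_const DIM('a) * \<tau>)"
proof -
  let ?n = "real DIM('a)" and ?K = "annulus_const DIM('a)"
  note K = annulus_const_ge_1[of "DIM('a)"]
  have *: "var_Lebesgue_norm UNIV q (\<lambda>x. g x * indicator (dyadic_annulus k) x) \<le> ennreal \<eta>"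
    if \<eta>: "0 < \<eta>" "?K * \<tau> \<le> \<eta>" for \<eta>
  proof -
    have "modular UNIV q (\<lambda>x. g x * indicator (dyadic_annulus k) x / \<eta>)
        \<le> (\<integral>\<^sup>+x\<in>(dyadic_annulus k :: 'a set). ennreal (norm x powr - ?n) * ennreal (1 / ?K) \<partial>lebesgue)"
      unfolding modular_def
    proof (intro nn_integral_mono_AE, use q g in eventually_elim)
      fix x :: 'a
      assume q: "1 \<le> q x"
        and g: "x \<in> dyadic_annulus k \<longrightarrow> \<bar>g x\<bar> \<le> \<tau> * norm x powr (- ?n / q x)"
      have "\<bar>g x / \<eta>\<bar> powr q x \<le> norm x powr - ?n * (1 / ?K)" if x: "x \<in> dyadic_annulus k"
      proof -
        have "\<bar>g x / \<eta>\<bar> \<le> \<tau> / \<eta> * norm x powr (- ?n / q x)"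
          using g x \<eta> by (simp add: divide_right_mono)
        also have "\<tau> / \<eta> \<le> 1 / ?K" using \<eta> K by (simp add: field_simps)
        finally have "\<bar>g x / \<eta>\<bar> \<le> 1 / ?K * norm x powr (- ?n / q x)" by (simp add: mult_right_mono)
        then have "\<bar>g x / \<eta>\<bar> powr q x \<le> (1 / ?K * norm x powr (- ?n / q x)) powr q x"
          using q by (intro powr_mono2) auto
        also have "\<dots> = (1 / ?K) powr q x * norm x powr - ?n"
          using q K by (subst powr_mult) (auto simp: powr_powr)
        also have "(1 / ?K) powr q x \<le> (1 / ?K) powr 1"
          using q K by (intro powr_mono') auto
        finally show ?thesis using K by (simp add: mult_ac mult_right_mono)
      qed
      then show "ennreal (\<bar>g x * indicator (dyadic_annulus k) x / \<eta>\<bar> powr q x) * indicator UNIV x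
          \<le> ennreal (norm x powr - ?n) * ennreal (1 / ?K) * indicator (dyadic_annulus k) x"
        using K by (cases "x \<in> dyadic_annulus k") (auto simp flip: ennreal_mult intro!: ennreal_leI)
    qed
    also have "\<dots> = ennreal (1 / ?K) * (\<integral>\<^sup>+x\<in>(dyadic_annulus k :: 'a set). ennreal (norm x powr - ?n) \<partial>lebesgue)"
    proof (subst nn_integral_cmult[symmetric])
      show "(\<lambda>x::'a. ennreal (norm x powr - ?n) * indicator (dyadic_annulus k) x) \<in> borel_measurable lebesgue"
        by measurable
    qed (simp add: mult_ac)
    also have "\<dots> \<le> ennreal (1 / ?K) * ennreal (?K - 1)"
      by (intro mult_left_mono nn_integral_annulus_norm_powr_le) auto
    also have "\<dots> \<le> 1"
      using K by (simp add: ennreal_mult[symmetric] ennreal_le_1 field_simps)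
    finally show ?thesis unfolding var_Lebesgue_norm_def using \<eta> by (intro Inf_lower) auto
  qed
  \<comment> \<open>The passage to the limit covers \<open>\<tau> = 0\<close>, where no positive \<open>\<eta>\<close> equals the bound.\<close>
  show ?thesis
  proof (rule ennreal_le_epsilon)
    fix e :: real assume "0 < e"
    then have "var_Lebesgue_norm UNIV q (\<lambda>x. g x * indicator (dyadic_annulus k) x) \<le> ennreal (?K * \<tau> + e)"
      using K \<tau> by (intro *) (auto intro: add_nonneg_pos)
    then show "var_Lebesgue_norm UNIV q (\<lambda>x. g x * indicator (dyadic_annulus k) x) \<le> ennreal (?K * \<tau>) + ennreal e"
      using K \<tau> \<open>0 < e\<close> by (simp add: ennreal_plus)
  qed
qed

text \<open>
  Hoelder's inequality against the critical function of the conjugate exponent,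
  \<open>|t|\<^sup>n\<^sup>/\<^sup>q\<^sup>(\<^sup>t\<^sup>)\<^sup>-\<^sup>n\<close>, but without conjugate exponents: apply \<open>v \<le> 1 + v\<^sup>q\<close> to
  \<open>v = |f(t) / \<eta>| |t|\<^sup>n\<^sup>/\<^sup>q\<^sup>(\<^sup>t\<^sup>)\<close>, multiply by \<open>\<eta> |t|\<^sup>-\<^sup>n\<close> and integrate. The term \<open>|t|\<^sup>-\<^sup>n\<close> has bounded
  integral over the annulus, and the other is the modular of \<open>f / \<eta>\<close>, which is at most 1.
\<close>

lemma nn_integral_annulus_le_var_Lebesgue_norm:
  fixes q f :: "'a::euclidean_space \<Rightarrow> real"
  assumes q: "\<And>x. 1 \<le> q x" and [measurable]: "f \<in> borel_measurable lebesgue" "q \<in> borel_measurable lebesgue"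
  shows "(\<integral>\<^sup>+t\<in>(dyadic_annulus j :: 'a set). ennreal (\<bar>f t\<bar> * norm t powr (real DIM('a) / q t - real DIM('a))) \<partial>lebesgue)
    \<le> ennreal (annulus_const DIM('a)) * var_Lebesgue_norm UNIV q (\<lambda>x. f x * indicator (dyadic_annulus j) x)"
    (is "?I \<le> _")
proof -
  let ?n = "real DIM('a)" and ?K = "annulus_const DIM('a)"
  note K = annulus_const_ge_1[of "DIM('a)"]
  have "?I / ennreal ?K \<le> ennreal \<eta>"
    if \<eta>: "0 < \<eta>" and m: "modular UNIV q (\<lambda>x. f x * indicator (dyadic_annulus j) x / \<eta>) \<le> 1" for \<eta>
  proof -
    have young: "\<bar>f t\<bar> * norm t powr (?n / q t - ?n) \<le> \<eta> * (norm t powr - ?n + \<bar>f t / \<eta>\<bar> powr q t)"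
      if "t \<noteq> 0" for t
    proof -
      define v where "v = \<bar>f t / \<eta>\<bar> * norm t powr (?n / q t)"
      have "v \<le> 1 + v powr q t"
      proof (cases "v \<le> 1")
        case False
        then have "v powr 1 \<le> v powr q t" using q[of t] by (intro powr_mono) auto
        then show ?thesis using False by simp
      qed (simp add: add_increasing2)
      also have "v powr q t = \<bar>f t / \<eta>\<bar> powr q t * norm t powr ?n"
        using q[of t] unfolding v_def by (subst powr_mult) (auto simp: powr_powr)
      finally have "\<eta> * norm t powr - ?n * v \<le> \<eta> * norm t powr - ?n * (1 + \<bar>f t / \<eta>\<bar> powr q t * norm t powr ?n)"
        using \<eta> by (intro mult_left_mono) auto
      also have "\<dots> = \<eta> * (norm t powr - ?n + \<bar>f t / \<eta>\<bar> powr q t * (norm t powr - ?n * norm t powr ?n))"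
        by (simp add: algebra_simps)
      also have "norm t powr - ?n * norm t powr ?n = 1"
        using that by (simp flip: powr_add)
      also have "\<eta> * norm t powr - ?n * v = \<bar>f t\<bar> * (norm t powr - ?n * norm t powr (?n / q t))"
        using \<eta> by (simp add: v_def)
      also have "norm t powr - ?n * norm t powr (?n / q t) = norm t powr (?n / q t - ?n)"
        by (simp flip: powr_add)
      finally show ?thesis by simp
    qed
    have "?I \<le> (\<integral>\<^sup>+t. ennreal \<eta> * (ennreal (norm t powr - ?n) * indicator (dyadic_annulus j) t
           + ennreal (\<bar>f t * indicator (dyadic_annulus j) t / \<eta>\<bar> powr q t)) \<partial>lebesgue)"
    proof (intro nn_integral_mono)
      fix t :: 'a
      show "ennreal (\<bar>f t\<bar> * norm t powr (?n / q t - ?n)) * indicator (dyadic_annulus j) t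
        \<le> ennreal \<eta> * (ennreal (norm t powr - ?n) * indicator (dyadic_annulus j) t
           + ennreal (\<bar>f t * indicator (dyadic_annulus j) t / \<eta>\<bar> powr q t))"
        using young[of t] \<eta> dyadic_annulus_nonzero[of t j]
        by (cases "t \<in> dyadic_annulus j")
           (auto simp: simp flip: ennreal_plus ennreal_mult intro!: ennreal_leI)
    qed
    also have "\<dots> = ennreal \<eta> * (\<integral>\<^sup>+t. ennreal (norm t powr - ?n) * indicator (dyadic_annulus j) t
           + ennreal (\<bar>f t * indicator (dyadic_annulus j) t / \<eta>\<bar> powr q t) \<partial>lebesgue)"
      by (rule nn_integral_cmult) measurable
    also have "\<dots> = ennreal \<eta> * ((\<integral>\<^sup>+t\<in>(dyadic_annulus j :: 'a set). ennreal (norm t powr - ?n) \<partial>lebesgue)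
        + modular UNIV q (\<lambda>x. f x * indicator (dyadic_annulus j) x / \<eta>))"
      unfolding modular_def indicator_UNIV mult_1_right
      by (rule arg_cong[where f = "(*) (ennreal \<eta>)"], rule nn_integral_add) measurable
    also have "\<dots> \<le> ennreal \<eta> * (ennreal (?K - 1) + 1)"
      by (intro mult_left_mono add_mono nn_integral_annulus_norm_powr_le m) auto
    also have "\<dots> = ennreal \<eta> * ennreal ?K"
      using K by (simp flip: ennreal_plus ennreal_1)
    finally show ?thesis
      using K by (simp add: divide_le_posI_ennreal mult.commute)
  qed
  then have "?I / ennreal ?K \<le> var_Lebesgue_norm UNIV q (\<lambda>x. f x * indicator (dyadic_annulus j) x)"
    unfolding var_Lebesgue_norm_def by (intro Inf_greatest) auto
  then have "ennreal ?K * (?I / ennreal ?K) \<le> ennreal ?K * var_Lebesgue_norm UNIV q (\<lambda>x. f x * indicator (dyadic_annulus j) x)"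
    by (rule mult_left_mono) auto
  moreover have "ennreal ?K * (?I / ennreal ?K) = ?I"
    unfolding ennreal_times_divide
    using K by (subst mult.commute, intro mult_divide_eq_ennreal) auto
  ultimately show ?thesis by simp
qed

text \<open>
  A compact set that avoids the origin meets only finitely many annuli, so the largest of the
  corresponding scaling factors \<open>\<eta>\<close> makes the modular finite on it.
\<close>

lemma var_Lebesgue_locI_annuli:
  fixes q g :: "'a::euclidean_space \<Rightarrow> real"
  assumes [measurable]: "g \<in> borel_measurable lebesgue" "q \<in> borel_measurable lebesgue"
    and q: "AE x in lebesgue. 0 \<le> q x"
    and fin: "\<And>k. var_Lebesgue_norm UNIV q (\<lambda>x. g x * indicator (dyadic_annulus k) x) < \<infinity>"
  shows "g \<in> var_Lebesgue_loc (UNIV - {0}) q"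
proof -
  let ?h = "\<lambda>k x. g x * indicator (dyadic_annulus k) x"
  have "\<forall>k. \<exists>\<eta>>0. modular UNIV q (\<lambda>x. ?h k x / \<eta>) \<le> 1"
  proof
    fix k
    have "Inf {ennreal \<eta> | \<eta>. 0 < \<eta> \<and> modular UNIV q (\<lambda>x. ?h k x / \<eta>) \<le> 1} < \<infinity>"
      using fin[of k] by (simp add: var_Lebesgue_norm_def)
    then show "\<exists>\<eta>>0. modular UNIV q (\<lambda>x. ?h k x / \<eta>) \<le> 1" unfolding Inf_less_iff by auto
  qed
  then obtain \<eta> where \<eta>: "\<And>k. 0 < \<eta> k" "\<And>k. modular UNIV q (\<lambda>x. ?h k x / \<eta> k) \<le> 1" by metis
  have "g \<in> var_Lebesgue K q" if K: "compact K" "K \<subseteq> UNIV - {0}" for K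
  proof -
    have Kset: "K \<in> sets lebesgue" using K(1) by (simp add: lmeasurable_compact fmeasurableD)
    obtain J :: "int set" where J: "finite J" "J \<noteq> {}" "K \<subseteq> (\<Union>k\<in>J. dyadic_annulus k)"
    proof -
      have "\<exists>a b. 0 < a \<and> (\<forall>x\<in>K. a \<le> norm x \<and> norm x \<le> b)"
      proof (cases "K = {}")
        case False
        have "continuous_on K norm" by (intro continuous_intros)
        then obtain x y where "x \<in> K" "\<forall>z\<in>K. norm x \<le> norm z" "y \<in> K" "\<forall>z\<in>K. norm z \<le> norm y"
          using continuous_attains_inf[OF K(1) False] continuous_attains_sup[OF K(1) False] by metis
        then show ?thesis using K(2) by (intro exI[of _ "norm x"] exI[of _ "norm y"]) auto
      qed (auto intro: exI[of _ 1])
      then obtain a b where ab: "0 < a" "\<And>x. x \<in> K \<Longrightarrow> a \<le> norm x \<and> norm x \<le> b" by auto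
      \<comment> \<open>The index 0 is added so that the index set is nonempty and the maximum below exists.\<close>
      have "K \<subseteq> (\<Union>k\<in>insert 0 {\<lceil>log 2 a\<rceil>..\<lceil>log 2 b\<rceil>}. dyadic_annulus k)"
      proof
        fix x assume "x \<in> K"
        then have "x \<noteq> 0" "a \<le> norm x" "norm x \<le> b" using ab K(2) by auto
        then have "\<lceil>log 2 (norm x)\<rceil> \<in> {\<lceil>log 2 a\<rceil>..\<lceil>log 2 b\<rceil>}"
          using ab(1) by (auto intro!: ceiling_mono)
        then show "x \<in> (\<Union>k\<in>insert 0 {\<lceil>log 2 a\<rceil>..\<lceil>log 2 b\<rceil>}. dyadic_annulus k)"
          using mem_dyadic_annulus_ceiling[OF \<open>x \<noteq> 0\<close>] by blast
      qed
      then show ?thesis by (intro that[of "insert 0 {\<lceil>log 2 a\<rceil>..\<lceil>log 2 b\<rceil>}"]) auto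
    qed
    define H where "H = Max (\<eta> ` J)"
    have H: "\<eta> k \<le> H" if "k \<in> J" for k using J that by (simp add: H_def)
    have "0 < H" using J(2) H \<eta>(1) by (meson ex_in_conv less_le_trans)
    have "modular K q (\<lambda>x. g x / H) \<le> (\<integral>\<^sup>+x. (\<Sum>k\<in>J. ennreal (\<bar>?h k x / \<eta> k\<bar> powr q x)) \<partial>lebesgue)"
      unfolding modular_def
    proof (intro nn_integral_mono_AE, use q in eventually_elim)
      fix x :: 'a assume q: "0 \<le> q x"
      show "ennreal (\<bar>g x / H\<bar> powr q x) * indicator K x \<le> (\<Sum>k\<in>J. ennreal (\<bar>?h k x / \<eta> k\<bar> powr q x))"
      proof (cases "x \<in> K")
        case True
        then obtain k where k: "k \<in> J" "x \<in> dyadic_annulus k" using J by auto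
        have "\<bar>g x\<bar> / H \<le> \<bar>g x\<bar> / \<eta> k"
          using H[OF k(1)] \<eta>(1)[of k] by (intro divide_left_mono) auto
        then have "\<bar>g x / H\<bar> powr q x \<le> \<bar>?h k x / \<eta> k\<bar> powr q x"
          using q k \<eta>(1)[of k] \<open>0 < H\<close> by (intro powr_mono2) auto
        then have "ennreal (\<bar>g x / H\<bar> powr q x) \<le> ennreal (\<bar>?h k x / \<eta> k\<bar> powr q x)" by (rule ennreal_leI)
        also have "\<dots> \<le> (\<Sum>k\<in>J. ennreal (\<bar>?h k x / \<eta> k\<bar> powr q x))"
          using J k by (intro member_le_sum) auto
        finally show ?thesis using True by simp
      qed simp
    qed
    also have "\<dots> = (\<Sum>k\<in>J. modular UNIV q (\<lambda>x. ?h k x / \<eta> k))"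
      unfolding modular_def by (subst nn_integral_sum) auto
    also have "\<dots> \<le> (\<Sum>k\<in>J. 1)" by (intro sum_mono \<eta>)
    also have "\<dots> < \<infinity>" by (simp add: of_nat_less_top)
    finally have "modular K q (\<lambda>x. g x / H) < \<infinity>" .
    moreover have "g \<in> borel_measurable (lebesgue_on K)" by (rule measurable_restrict_space1) fact
    ultimately show ?thesis using \<open>0 < H\<close> unfolding var_Lebesgue_def by blast
  qed
  moreover have "g \<in> borel_measurable (lebesgue_on (UNIV - {0}))" by (rule measurable_restrict_space1) fact
  ultimately show ?thesis unfolding var_Lebesgue_loc_def by blast
qed

section \<open>The log-Hoelder condition\<close>

text \<open>
  For \<open>|t|\<close> small, \<open>|x - t| \<le> 2 |t|\<close>, so the local log-Hoelder condition bounds the exponent by a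
  multiple of \<open>1 / ln (1 / |t|)\<close>. For \<open>|t| \<ge> 1\<close> the point \<open>x\<close> may be close to the origin, where
  \<open>q x\<close> may be far from \<open>q t\<close>; but there only an upper bound for the exponent is wanted, and
  \<open>1 / q x\<close> is at most \<open>1 / q(\<infinity>)\<close>, which is close to \<open>1 / q t\<close> by the decay condition. This is
  where the hypothesis that \<open>q\<close> is bounded below by its limit at infinity enters.
\<close>

lemma log_Hoelder_norm_powr_bounded:
  fixes q :: "'a::euclidean_space \<Rightarrow> real"
  assumes q: "q \<in> log_Hoelder" and inf: "1 \<le> exp_infty q" "\<And>x. exp_infty q \<le> q x"
  obtains K where "0 < K"
    "\<And>x t. norm x \<le> norm t \<Longrightarrow> t \<noteq> 0 \<Longrightarrow> norm t powr (1 / q x - 1 / q t) \<le> K"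
proof -
  obtain C where C: "0 < C" "\<And>x y. norm (x - y) \<le> 1/2 \<Longrightarrow> \<bar>q x - q y\<bar> \<le> - C / ln (norm (x - y))"
    using q unfolding log_Hoelder_def by blast
  obtain C' where C': "0 < C'" "\<And>x. \<bar>q x - exp_infty q\<bar> \<le> C' / ln (exp 1 + norm x)"
    using q unfolding log_Hoelder_def by blast
  have q1: "1 \<le> q x" for x using inf(1) inf(2)[of x] by simp
  have inverse_diff: "\<bar>1 / a - 1 / b\<bar> \<le> \<bar>a - b\<bar>" if "1 \<le> a" "1 \<le> b" for a b :: real
  proof -
    have "\<bar>1 / a - 1 / b\<bar> = \<bar>a - b\<bar> / (a * b)"
      using that by (simp add: abs_mult abs_minus_commute diff_frac_eq abs_divide)
    also have "\<dots> \<le> \<bar>a - b\<bar> / 1"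
      using that mult_mono[of 1 a 1 b] by (intro divide_left_mono) auto
    finally show ?thesis by simp
  qed
  have "norm t powr (1 / q x - 1 / q t) \<le> max (exp C') (max 4 (exp (2 * C)))"
    if le: "norm x \<le> norm t" and t: "t \<noteq> 0" for x t
  proof -
    let ?u = "1 / q x - 1 / q t"
    have powr_eq: "norm t powr ?u = exp (?u * ln (norm t))" using t by (simp add: powr_def)
    \<comment> \<open>Below \<open>1 / 4\<close>, both \<open>norm (x - t) \<le> 1 / 2\<close> and \<open>ln (norm (x - t)) \<le> ln (norm t) / 2\<close>.\<close>
    consider "1 \<le> norm t" | "1 / 4 \<le> norm t" "norm t < 1" | "norm t < 1 / 4" by linarith
    then show ?thesis
    proof cases
      case 1
      have "?u \<le> 1 / exp_infty q - 1 / q t"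
        using inf(1) inf(2)[of x] by (simp add: frac_le)
      also have "\<dots> \<le> \<bar>q t - exp_infty q\<bar>"
        using inverse_diff[of "exp_infty q" "q t"] inf(1) q1[of t] by linarith
      also have "\<dots> \<le> C' / ln (exp 1 + norm t)" by (rule C')
      finally have "?u * ln (norm t) \<le> C' / ln (exp 1 + norm t) * ln (norm t)"
        using 1 by (intro mult_right_mono) auto
      also have "\<dots> \<le> C' / ln (exp 1 + norm t) * ln (exp 1 + norm t)"
      proof (intro mult_left_mono)
        show "ln (norm t) \<le> ln (exp 1 + norm t)" using 1 by (intro ln_mono) (auto intro: add_nonneg_pos)
        show "0 \<le> C' / ln (exp 1 + norm t)"
          using C'(1) by (intro divide_nonneg_nonneg ln_ge_zero) (auto intro: add_increasing2)
      qed
      also have "\<dots> \<le> C'"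
        using C'(1) by simp
      finally show ?thesis unfolding powr_eq by (simp add: le_max_iff_disj)
    next
      case 2
      have "- 1 \<le> ?u" using q1[of x] q1[of t] by (smt (verit) divide_le_eq_1 zero_le_divide_1_iff)
      then have "norm t powr ?u \<le> norm t powr (- 1)" using 2 t by (intro powr_mono') auto
      also have "\<dots> \<le> 4" using 2 t by (simp add: powr_minus field_simps)
      finally show ?thesis by simp
    next
      case 3
      show ?thesis
      proof (cases "x = t")
        case True
        then show ?thesis using t by (simp add: le_max_iff_disj)
      next
        case False
        have dist: "norm (x - t) \<le> 2 * norm t" using norm_triangle_ineq4[of x t] le by simp
        have "\<bar>?u\<bar> \<le> \<bar>q x - q t\<bar>" using inverse_diff q1 by blast
        also have "\<dots> \<le> - C / ln (norm (x - t))" using dist 3 by (intro C) simp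
        finally have u: "\<bar>?u\<bar> \<le> C / (- ln (norm (x - t)))" by simp
        have "ln (norm (x - t)) \<le> ln (2 * norm t)" using False dist t by (intro ln_mono) auto
        also have "ln (2 * norm t) = ln 2 + ln (norm t)" using t by (simp add: ln_mult)
        finally have d: "ln (norm (x - t)) \<le> ln 2 + ln (norm t)" .
        have "ln (norm t) \<le> ln (1 / 4)" using 3 t by (intro ln_mono) auto
        also have "ln (1 / 4 :: real) = - (ln (2 * 2))" by (simp add: ln_div)
        also have "\<dots> = - 2 * ln 2" by (subst ln_mult) auto
        finally have t4: "ln (norm t) \<le> - 2 * ln 2" .
        have ln2: "0 < ln (2 :: real)" by simp
        have pos: "0 < - ln (norm (x - t))" using d t4 ln2 by linarith
        have "?u * ln (norm t) \<le> \<bar>?u\<bar> * \<bar>ln (norm t)\<bar>" by (metis abs_ge_self abs_mult)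
        also have "\<dots> \<le> C / (- ln (norm (x - t))) * (2 * (- ln (norm (x - t))))"
        proof (rule mult_mono[OF u])
          show "\<bar>ln (norm t)\<bar> \<le> 2 * (- ln (norm (x - t)))" using d t4 ln2 by linarith
          show "0 \<le> C / (- ln (norm (x - t)))" using C(1) pos by (intro divide_nonneg_nonneg) auto
        qed simp
        also have "\<dots> = 2 * C" using pos by simp
        finally show ?thesis unfolding powr_eq by (simp add: le_max_iff_disj)
      qed
    qed
  qed
  then show ?thesis by (intro that[of "max (exp C') (max 4 (exp (2 * C)))"]) (auto simp: less_max_iff_disj)
qed

section \<open>The adjoint Hardy operator\<close>

text \<open>
  Here \<open>r = |x|\<close>, \<open>R = |t|\<close>, \<open>a = 1 / q\<^sub>1(x)\<close>, \<open>a' = 1 / q\<^sub>1(t)\<close>, \<open>b = \<beta>(x)\<close>, \<open>c = 1 / q\<^sub>2(x)\<close> and \<open>d = \<delta>\<^sub>2\<close>. The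
  kernel \<open>R powr (b - n)\<close> is the product of \<open>R powr (- n c)\<close>, \<open>R powr (n a' - n)\<close> and the \<open>n\<close>-th power of
  \<open>R powr (a - a')\<close>. Replacing \<open>R powr (- n c)\<close> by \<open>r powr (- n c)\<close> gains \<open>(r / R) powr (n c)\<close>, and
  \<open>d \<le> c\<close> turns this into a decay rate that is uniform in \<open>x\<close>.
\<close>

lemma powr_kernel_le:
  fixes r R n a a' b c d K :: real
  assumes r: "0 < r" "r \<le> R" and n: "0 < n" and c: "c = a - b / n" and d: "d \<le> c"
    and K: "R powr (a - a') \<le> K"
  shows "R powr (b - n) \<le> K powr n * r powr (- n * c) * (r / R) powr (n * d) * R powr (n * a' - n)"
proof -
  have R: "0 < R" using r by simp
  have b: "b = n * (a - c)" using n c by (simp add: field_simps)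
  have "R powr (b - n) = (R powr (a - a')) powr n * R powr (- n * c) * R powr (n * a' - n)"
    unfolding b powr_powr powr_add[symmetric] by (rule arg_cong) (simp add: algebra_simps)
  also have "R powr (- n * c) = r powr (- n * c) * (r / R) powr (n * c)"
    using r R by (simp add: powr_divide powr_minus field_simps)
  also have "(R powr (a - a')) powr n * (r powr (- n * c) * (r / R) powr (n * c)) * R powr (n * a' - n)
     \<le> K powr n * (r powr (- n * c) * (r / R) powr (n * d)) * R powr (n * a' - n)"
    using r R n d K by (intro mult_right_mono mult_mono mult_left_mono powr_mono2 powr_mono') auto
  finally show ?thesis by (simp only: mult.assoc)
qed

lemma sigma_finite_lebesgue: "sigma_finite_measure (lebesgue :: 'a::euclidean_space measure)"
proof
  show "\<exists>A::'a set set. countable A \<and> A \<subseteq> sets lebesgue \<and> \<Union> A = space lebesgue \<and>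
      (\<forall>a\<in>A. emeasure lebesgue a \<noteq> \<infinity>)"
  proof (intro exI[of _ "range (\<lambda>i::nat. cball 0 (real i))"] conjI)
    show "\<Union> (range (\<lambda>i::nat. cball (0::'a) (real i))) = space lebesgue"
      by (auto simp: real_arch_simple)
  qed (auto simp: emeasure_cball)
qed

lemma borel_measurable_hardy_adj_kernel:
  assumes [measurable]: "f \<in> borel_measurable lebesgue"
  shows "hardy_adj_kernel \<beta> f x \<in> borel_measurable lebesgue"
  unfolding hardy_adj_kernel_def by measurable

lemma borel_measurable_hardy_adj:
  assumes [measurable]: "f \<in> borel_measurable lebesgue" "\<beta> \<in> borel_measurable lebesgue"
  shows "hardy_adj \<beta> f \<in> borel_measurable lebesgue"
proof -
  interpret sigma_finite_measure "lebesgue :: (real ^ 'n) measure" by (rule sigma_finite_lebesgue)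
  have "(\<lambda>x. LINT t|lebesgue. (if norm x \<le> norm t then hardy_adj_kernel \<beta> f x t else 0))
      \<in> borel_measurable lebesgue"
    unfolding hardy_adj_kernel_def by (rule borel_measurable_lebesgue_integral) measurable
  moreover have "hardy_adj \<beta> f = (\<lambda>x. LINT t|lebesgue. (if norm x \<le> norm t then hardy_adj_kernel \<beta> f x t else 0))"
    unfolding hardy_adj_def set_lebesgue_integral_def
    by (intro ext Bochner_Integration.integral_cong) (auto simp: indicator_def)
  ultimately show ?thesis by simp
qed

text \<open>
  On the annulus that lies \<open>i\<close> steps outside that of \<open>x\<close>, \<open>|x| / |t|\<close> is at most \<open>2\<^sup>1\<^sup>-\<^sup>i\<close>. Hence the kernel
  estimate gives geometric decay in \<open>i\<close>, and the integral of \<open>|f|\<close> against the remaining weight is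
  controlled by the norm of \<open>f\<close> on that annulus.
\<close>

lemma nn_integral_hardy_adj_kernel_le:
  fixes f q \<beta> :: "real ^ 'n \<Rightarrow> real" and \<nu> :: "int \<Rightarrow> real" and x :: "real ^ 'n"
  defines "n \<equiv> real CARD('n)"
  assumes [measurable]: "f \<in> borel_measurable lebesgue" "q \<in> borel_measurable lebesgue"
    and q: "\<And>t. 1 \<le> q t"
    and K: "\<And>t. norm x \<le> norm t \<Longrightarrow> t \<noteq> 0 \<Longrightarrow> norm t powr (1 / q x - 1 / q t) \<le> K"
    and x: "x \<in> dyadic_annulus k"
    and c: "c = 1 / q x - \<beta> x / n" and d: "0 \<le> d" "d \<le> c"
    and \<nu>: "\<And>j. 0 \<le> \<nu> j"
      "\<And>j. var_Lebesgue_norm UNIV q (\<lambda>x. f x * indicator (dyadic_annulus j) x) \<le> ennreal (\<nu> j)"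
    and sum: "summable (\<lambda>i. 2 powr (- real i * (n * d)) * \<nu> (k + int i))"
  shows "(\<integral>\<^sup>+t\<in>{t. norm x \<le> norm t}. ennreal (norm (hardy_adj_kernel \<beta> f x t)) \<partial>lebesgue)
    \<le> ennreal (K powr n * annulus_const CARD('n) * 2 powr (n * d) *
         (\<Sum>i. 2 powr (- real i * (n * d)) * \<nu> (k + int i)) * norm x powr (- n * c))"
proof -
  note [measurable] = borel_measurable_hardy_adj_kernel
  have x0: "x \<noteq> 0" using x by (rule dyadic_annulus_nonzero)
  have n: "0 < n" by (simp add: n_def)
  define G where "G i = K powr n * norm x powr (- n * c) * (2 powr (n * d) * 2 powr (- real i * (n * d)))" for i :: nat
  have G: "0 \<le> G i" for i by (simp add: G_def)
  define w where "w t = \<bar>f t\<bar> * norm t powr (n / q t - n)" for t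
  have [measurable]: "w \<in> borel_measurable lebesgue" unfolding w_def by measurable
  have pointwise: "norm (hardy_adj_kernel \<beta> f x t) \<le> G i * w t"
    if le: "norm x \<le> norm t" and t: "t \<in> dyadic_annulus (k + int i)" for t i
  proof -
    have t0: "t \<noteq> 0" using t by (rule dyadic_annulus_nonzero)
    have "norm x / norm t \<le> 2 powr real_of_int k / 2 powr (real_of_int (k + int i) - 1)"
      using x t by (intro frac_le) (auto simp: dyadic_annulus_iff)
    also have "\<dots> = 2 powr (1 - real i)" by (simp flip: powr_diff)
    finally have "(norm x / norm t) powr (n * d) \<le> (2 powr (1 - real i)) powr (n * d)"
      using n d by (intro powr_mono2) auto
    also have "\<dots> = 2 powr (n * d) * 2 powr (- real i * (n * d))"
      by (simp add: powr_powr algebra_simps flip: powr_add)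
    finally have ratio: "(norm x / norm t) powr (n * d) \<le> 2 powr (n * d) * 2 powr (- real i * (n * d))" .
    have "norm t powr (\<beta> x - n) \<le> K powr n * norm x powr (- n * c) * (norm x / norm t) powr (n * d)
        * norm t powr (n * (1 / q t) - n)"
      using x0 le n c d K[OF le t0] by (intro powr_kernel_le[where a = "1 / q x"]) auto
    also have "\<dots> \<le> G i * norm t powr (n / q t - n)"
      unfolding G_def using ratio by (auto intro!: mult_right_mono mult_left_mono)
    finally have "\<bar>f t\<bar> * norm t powr (\<beta> x - n) \<le> \<bar>f t\<bar> * (G i * norm t powr (n / q t - n))"
      by (rule mult_left_mono) simp
    moreover have "norm (hardy_adj_kernel \<beta> f x t) = \<bar>f t\<bar> * norm t powr (\<beta> x - n)"
      using powr_minus_divide[of "norm t" "n - \<beta> x"] by (simp add: hardy_adj_kernel_def n_def abs_divide)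
    ultimately show ?thesis by (simp add: w_def mult_ac)
  qed
  have "(\<integral>\<^sup>+t\<in>{t. norm x \<le> norm t}. ennreal (norm (hardy_adj_kernel \<beta> f x t)) \<partial>lebesgue)
     \<le> (\<integral>\<^sup>+t. (\<Sum>i. ennreal (G i) * (ennreal (w t) * indicator (dyadic_annulus (k + int i)) t)) \<partial>lebesgue)"
  proof (rule nn_integral_mono)
    fix t :: "real ^ 'n"
    show "ennreal (norm (hardy_adj_kernel \<beta> f x t)) * indicator {t. norm x \<le> norm t} t
       \<le> (\<Sum>i. ennreal (G i) * (ennreal (w t) * indicator (dyadic_annulus (k + int i)) t))"
    proof (cases "norm x \<le> norm t")
      case True
      then obtain i where t: "t \<in> dyadic_annulus (k + int i)"
        using outside_ball_subset_annuli[OF x] by auto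
      have "ennreal (norm (hardy_adj_kernel \<beta> f x t)) \<le> ennreal (G i * w t)"
        using pointwise[OF True t] by (rule ennreal_leI)
      also have "\<dots> = ennreal (G i) * (ennreal (w t) * indicator (dyadic_annulus (k + int i)) t)"
        using t G by (simp add: ennreal_mult')
      also have "\<dots> \<le> (\<Sum>i. ennreal (G i) * (ennreal (w t) * indicator (dyadic_annulus (k + int i)) t))"
        using sum_le_suminf[OF summableI, of "{i}"] by simp
      finally show ?thesis using True by simp
    qed simp
  qed
  also have "\<dots> = (\<Sum>i. ennreal (G i) * (\<integral>\<^sup>+t\<in>dyadic_annulus (k + int i). ennreal (w t) \<partial>lebesgue))"
    by (simp add: nn_integral_suminf nn_integral_cmult)
  also have "\<dots> \<le> (\<Sum>i. ennreal (G i) * (ennreal (annulus_const CARD('n)) * ennreal (\<nu> (k + int i))))"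
  proof (intro suminf_le summableI mult_left_mono)
    fix i
    have "(\<integral>\<^sup>+t\<in>dyadic_annulus (k + int i). ennreal (w t) \<partial>lebesgue)
       \<le> ennreal (annulus_const CARD('n)) * var_Lebesgue_norm UNIV q (\<lambda>x. f x * indicator (dyadic_annulus (k + int i)) x)"
      using nn_integral_annulus_le_var_Lebesgue_norm[of q f "k + int i"] q by (simp add: w_def n_def)
    also have "\<dots> \<le> ennreal (annulus_const CARD('n)) * ennreal (\<nu> (k + int i))"
      by (intro mult_left_mono \<nu>) simp
    finally show "(\<integral>\<^sup>+t\<in>dyadic_annulus (k + int i). ennreal (w t) \<partial>lebesgue)
       \<le> ennreal (annulus_const CARD('n)) * ennreal (\<nu> (k + int i))" .
  qed simp
  also have "\<dots> = (\<Sum>i. ennreal (K powr n * annulus_const CARD('n) * 2 powr (n * d) * norm x powr (- n * c) *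
         (2 powr (- real i * (n * d)) * \<nu> (k + int i))))"
    using \<nu>(1) annulus_const_ge_1[of "CARD('n)"] G
    by (intro suminf_cong) (simp add: G_def mult_ac flip: ennreal_mult)
  also have "\<dots> = ennreal (\<Sum>i. K powr n * annulus_const CARD('n) * 2 powr (n * d) * norm x powr (- n * c) *
         (2 powr (- real i * (n * d)) * \<nu> (k + int i)))"
    using \<nu>(1) annulus_const_ge_1[of "CARD('n)"] by (intro suminf_ennreal2 summable_mult sum) auto
  also have "\<dots> = ennreal (K powr n * annulus_const CARD('n) * 2 powr (n * d) *
         (\<Sum>i. 2 powr (- real i * (n * d)) * \<nu> (k + int i)) * norm x powr (- n * c))"
    by (subst suminf_mult[OF sum]) (simp add: mult_ac)
  finally show ?thesis .
qed

lemma borel_measurable_lebesgue_punctured: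
  fixes f :: "'a::euclidean_space \<Rightarrow> real"
  assumes "f \<in> borel_measurable (lebesgue_on (UNIV - {a}))"
  shows "f \<in> borel_measurable lebesgue"
proof -
  have *: "(\<lambda>x. if x \<in> UNIV - {a} then f x else 0) \<in> borel_measurable lebesgue"
    using assms by (rule borel_measurable_if_I) auto
  have "{a} \<in> sets lebesgue" by simp
  then have "(\<lambda>x. (if x \<in> UNIV - {a} then f x else 0) + f a * indicator {a} x) \<in> borel_measurable lebesgue"
    using * by measurable
  moreover have "(\<lambda>x. (if x \<in> UNIV - {a} then f x else 0) + f a * indicator {a} x) = f"
    by (auto simp: fun_eq_iff)
  ultimately show ?thesis by simp
qed

text \<open>
  On a null set \<open>1 / q\<^sub>2\<close> may be zero or negative, so the bounds hold only almost everywhere. The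
  condition on the essential supremum of \<open>q\<^sub>1 \<beta>\<close> makes \<open>1 / q\<^sub>2\<close> positive almost everywhere; without this
  sign, the condition on \<open>exp_plus q2\<close> would not give a lower bound for \<open>1 / q\<^sub>2\<close>.
\<close>

lemma AE_exponent_bounds:
  fixes q1 q2 \<beta> :: "'a::euclidean_space \<Rightarrow> real"
  assumes n: "0 < n" and q1: "\<And>x. 1 \<le> q1 x" and \<beta>: "\<And>x. 0 \<le> \<beta> x"
    and sup: "esssup lebesgue (\<lambda>x. ereal (q1 x * \<beta> x)) < ereal n"
    and q2: "\<And>x. 1 / q2 x = 1 / q1 x - \<beta> x / n"
    and d: "0 < d" "ereal d < 1 / exp_plus q2"
  shows "AE x in lebesgue. 1 \<le> q2 x \<and> d \<le> 1 / q2 x"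
  using esssup_AE[of "\<lambda>x. ereal (q1 x * \<beta> x)" lebesgue] esssup_AE[of "\<lambda>x. ereal (q2 x)" lebesgue]
proof eventually_elim
  case (elim x)
  have "ereal (q1 x * \<beta> x) < ereal n" using elim(1) sup by (rule le_less_trans)
  then have "\<beta> x / n < 1 / q1 x" using n q1[of x] by (simp add: field_simps)
  then have pos: "0 < 1 / q2 x" using q2[of x] by simp
  have "1 / q2 x \<le> 1 / q1 x" using q2[of x] \<beta>[of x] n by simp
  also have "\<dots> \<le> 1" using q1[of x] by simp
  finally have "1 \<le> q2 x" using pos by (simp add: divide_le_eq_1)
  moreover have "d \<le> 1 / q2 x"
  proof (cases "exp_plus q2")
    case (real e)
    then have "q2 x \<le> e" using elim(2) by (simp add: exp_plus_def)
    moreover have "d < 1 / e"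
      using d(2) real \<open>1 \<le> q2 x\<close> \<open>q2 x \<le> e\<close> by (simp add: one_ereal_def)
    moreover have "1 / e \<le> 1 / q2 x" using \<open>1 \<le> q2 x\<close> \<open>q2 x \<le> e\<close> by (intro divide_left_mono) auto
    ultimately show ?thesis by linarith
  qed (use d elim(2) in \<open>auto simp: exp_plus_def\<close>)
  ultimately show ?case by simp
qed

theorem theorem3p2:
  fixes q1 q2 \<beta> \<gamma> :: "real ^ 'n \<Rightarrow> real"
    and Cinf \<delta>2 p1 p2 \<alpha> lam :: real
  assumes "q1 \<in> log_Hoelder \<inter> exponents"
    and "1 < exp_infty q1"
    and "\<And>x. exp_infty q1 \<le> q1 x"
    and "\<And>x. ereal (q1 x) \<le> exp_plus q1"
    and "exp_plus q1 < \<infinity>"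
    and "\<beta> \<in> borel_measurable lebesgue"
    and "\<And>x. 0 \<le> \<beta> x \<and> \<beta> x < real CARD('n)"
    and "essinf lebesgue (\<lambda>x. ereal (\<beta> x)) > 0"
    and "esssup lebesgue (\<lambda>x. ereal (q1 x * \<beta> x)) < ereal (real CARD('n))"
    and "esssup lebesgue (\<lambda>x. ereal (exp_infty q1 * \<beta> x)) < ereal (real CARD('n))"
    and "\<And>x. 1 / q2 x = 1 / q1 x - \<beta> x / real CARD('n)"
    and "Cinf > 0"
    and "\<And>x. \<bar>q1 x - exp_infty q1\<bar> \<le> Cinf / ln (exp 1 + norm x)"
    and "\<And>x. \<gamma> x = Cinf * \<beta> x * (1 - \<beta> x / real CARD('n))"
    and "0 < \<delta>2"
    and "ereal \<delta>2 < 1 / exp_plus q2"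
    and "\<exists>C0>0. \<forall>(z::real ^ 'n) r S. 0 < r \<and> S \<in> sets lebesgue \<and> S \<subseteq> ball z r \<longrightarrow>
           var_Lebesgue_norm UNIV q2 (indicator S) / var_Lebesgue_norm UNIV q2 (indicator (ball z r))
             \<le> ennreal (C0 * (measure lebesgue S / measure lebesgue (ball z r)) powr \<delta>2)"
    and "0 < p1" and "p1 \<le> p2"
    and "0 \<le> lam"
    and "\<alpha> > lam - real CARD('n) * \<delta>2"
  shows "\<exists>C>0. \<forall>f \<in> herz_morrey \<alpha> lam p1 q1.
           (AE x in lebesgue. set_integrable lebesgue {t. norm x \<le> norm t} (hardy_adj_kernel \<beta> f x)) \<and>
           (\<lambda>x. (1 + norm x) powr (- \<gamma> x) * hardy_adj \<beta> f x) \<in> herz_morrey \<alpha> lam p2 q2 \<and>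
           herz_morrey_norm \<alpha> lam p2 q2 (\<lambda>x. (1 + norm x) powr (- \<gamma> x) * hardy_adj \<beta> f x)
             \<le> ennreal C * herz_morrey_norm \<alpha> lam p1 q1 f"
proof -
  let ?n = "real CARD('n)"
  have q1_meas: "q1 \<in> borel_measurable lebesgue" and q1_gt: "1 < q1 x" for x
    using assms(1) by (auto simp: exponents_def)
  have q1_ge: "1 \<le> q1 x" for x using q1_gt[of x] by simp
  have "q2 = (\<lambda>x. 1 / (1 / q1 x - \<beta> x / ?n))"
    unfolding assms(11)[symmetric] by simp
  also have "\<dots> \<in> borel_measurable lebesgue"
    using q1_meas assms(6) by measurable
  finally have q2_meas: "q2 \<in> borel_measurable lebesgue" .
  have "AE x in lebesgue. 1 \<le> q2 x \<and> \<delta>2 \<le> 1 / q2 x"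
    using q1_ge assms by (intro AE_exponent_bounds[of ?n q1 \<beta>]) auto
  then have AE_q2: "AE x in lebesgue. 1 \<le> q2 x" "AE x in lebesgue. \<delta>2 \<le> 1 / q2 x" by auto
  obtain K where K: "0 < K"
    "\<And>x t. norm x \<le> norm t \<Longrightarrow> t \<noteq> 0 \<Longrightarrow> norm t powr (1 / q1 x - 1 / q1 t) \<le> K"
    using log_Hoelder_norm_powr_bounded[of q1] assms(1-3) by (metis IntD1 less_imp_le)
  define s where "s = ?n * \<delta>2 + \<alpha>"
  have "lam < s" using assms(21) by (simp add: s_def)
  obtain D where D: "0 < D" and hardy: "\<forall>(a :: int \<Rightarrow> real) M. 0 \<le> M \<longrightarrow> (\<forall>k. 0 \<le> a k) \<longrightarrow>
     (\<forall>m F. finite F \<longrightarrow> F \<subseteq> {..m} \<longrightarrow>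
        (\<Sum>k\<in>F. a k powr p1) \<le> (M * 2 powr (real_of_int m * lam)) powr p1) \<longrightarrow>
     (\<forall>k. summable (\<lambda>i. 2 powr (- real i * s) * a (k + int i))) \<and>
     (\<forall>m F. finite F \<longrightarrow> F \<subseteq> {..m} \<longrightarrow>
        (\<Sum>k\<in>F. (\<Sum>i. 2 powr (- real i * s) * a (k + int i)) powr p2)
          \<le> (D * M * 2 powr (real_of_int m * lam)) powr p2)"
    using discrete_hardy_morrey[OF assms(18,19) \<open>lam < s\<close>] by (elim exE conjE)
  define A where "A = K powr ?n * annulus_const CARD('n) * 2 powr (?n * \<delta>2)"
  define B where "B = annulus_const CARD('n) * A"
  have A: "0 < A" and B: "0 < B"
    using K(1) annulus_const_ge_1[of "CARD('n)"] by (auto simp: A_def B_def)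
  show ?thesis
  proof (intro exI[of _ "B * D"] conjI ballI)
    show "0 < B * D" using B D by simp
    fix f assume f: "f \<in> herz_morrey \<alpha> lam p1 q1"
    then have f_meas: "f \<in> borel_measurable lebesgue"
      by (auto simp: herz_morrey_def var_Lebesgue_loc_def intro: borel_measurable_lebesgue_punctured)
    define M where "M = enn2real (herz_morrey_norm \<alpha> lam p1 q1 f)"
    have M: "0 \<le> M" "herz_morrey_norm \<alpha> lam p1 q1 f = ennreal M"
      using f by (auto simp: M_def herz_morrey_def)
    define N where "N j = var_Lebesgue_norm UNIV q1 (\<lambda>x. f x * indicator (dyadic_annulus j) x)" for j
    define \<nu> where "\<nu> j = enn2real (N j)" for j
    note le = herz_morrey_norm_leD[OF assms(18) M(1) eq_refl[OF M(2)], folded N_def, folded \<nu>_def]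
    have \<nu>: "0 \<le> \<nu> j" "N j = ennreal (\<nu> j)" for j using le(1)[of j] by (auto simp: \<nu>_def)
    define T where "T k = (\<Sum>i. 2 powr (- real i * (?n * \<delta>2)) * \<nu> (k + int i))" for k
    \<comment> \<open>The operator acts on the unweighted norms with decay rate \<open>n \<delta>2\<close>; on the norms weighted by
        \<open>2 powr (k * \<alpha>)\<close> this becomes the rate \<open>s\<close>, which exceeds \<open>lam\<close>.\<close>
    have shift: "2 powr (- real i * s) * (2 powr (real_of_int (k + int i) * \<alpha>) * \<nu> (k + int i))
        = 2 powr (real_of_int k * \<alpha>) * (2 powr (- real i * (?n * \<delta>2)) * \<nu> (k + int i))" for k i
    proof -
      have "2 powr (- real i * s) * 2 powr (real_of_int (k + int i) * \<alpha>)
          = 2 powr (real_of_int k * \<alpha>) * (2 powr (- real i * (?n * \<delta>2)) :: real)"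
        unfolding powr_add[symmetric] by (simp add: s_def algebra_simps)
      then show ?thesis by (simp only: mult.assoc[symmetric])
    qed
    have sums: "\<forall>m F. finite F \<longrightarrow> F \<subseteq> {..m} \<longrightarrow>
        (\<Sum>k\<in>F. (2 powr (real_of_int k * \<alpha>) * \<nu> k) powr p1) \<le> (M * 2 powr (real_of_int m * lam)) powr p1"
      using le(2) by blast
    have conv: "\<forall>k. summable (\<lambda>i. 2 powr (real_of_int k * \<alpha>) * (2 powr (- real i * (?n * \<delta>2)) * \<nu> (k + int i)))"
      and bound: "\<forall>m F. finite F \<longrightarrow> F \<subseteq> {..m} \<longrightarrow>
        (\<Sum>k\<in>F. (\<Sum>i. 2 powr (real_of_int k * \<alpha>) * (2 powr (- real i * (?n * \<delta>2)) * \<nu> (k + int i))) powr p2)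
          \<le> (D * M * 2 powr (real_of_int m * lam)) powr p2"
      using hardy[rule_format, of M "\<lambda>k. 2 powr (real_of_int k * \<alpha>) * \<nu> k", OF M(1) _ sums[rule_format], unfolded shift] \<nu>(1)
      by simp_all
    have sT: "summable (\<lambda>i. 2 powr (- real i * (?n * \<delta>2)) * \<nu> (k + int i))" for k
      using conv[rule_format, of k] by (subst (asm) summable_cmult_iff) auto
    have T: "0 \<le> T k" for k unfolding T_def using \<nu>(1) by (intro suminf_nonneg sT) auto
    have T_sums: "(\<Sum>k\<in>F. (2 powr (real_of_int k * \<alpha>) * T k) powr p2)
          \<le> (D * M * 2 powr (real_of_int m * lam)) powr p2" if "finite F" "F \<subseteq> {..m}" for F m
      using bound[rule_format, OF that] unfolding T_def suminf_mult[OF sT] .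
    let ?J = "\<lambda>x. \<integral>\<^sup>+t\<in>{t. norm x \<le> norm t}. ennreal (norm (hardy_adj_kernel \<beta> f x t)) \<partial>lebesgue"
    have kernel: "?J x \<le> ennreal (A * T k * norm x powr (- ?n / q2 x))"
      if "x \<in> dyadic_annulus k" "\<delta>2 \<le> 1 / q2 x" for x k
    proof -
      have "?J x \<le> ennreal (K powr ?n * annulus_const CARD('n) * 2 powr (?n * \<delta>2) * T k
          * norm x powr (- ?n * (1 / q2 x)))"
        unfolding T_def
        using that f_meas q1_meas q1_ge K(2) assms(11,15) \<nu> sT
        by (intro nn_integral_hardy_adj_kernel_le[where q = q1]) (auto simp flip: N_def)
      then show ?thesis by (simp add: A_def)
    qed
    have integrable: "set_integrable lebesgue {t. norm x \<le> norm t} (hardy_adj_kernel \<beta> f x)"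
      if "?J x < \<infinity>" for x
      unfolding set_integrable_def
    proof (rule integrableI_bounded)
      show "(\<lambda>t. indicator {t. norm x \<le> norm t} t *\<^sub>R hardy_adj_kernel \<beta> f x t) \<in> borel_measurable lebesgue"
        using borel_measurable_hardy_adj_kernel[OF f_meas] by measurable
      have "(\<integral>\<^sup>+t. ennreal (norm (indicator {t. norm x \<le> norm t} t *\<^sub>R hardy_adj_kernel \<beta> f x t)) \<partial>lebesgue) = ?J x"
        by (intro nn_integral_cong) (auto simp: indicator_def)
      then show "(\<integral>\<^sup>+t. ennreal (norm (indicator {t. norm x \<le> norm t} t *\<^sub>R hardy_adj_kernel \<beta> f x t)) \<partial>lebesgue) < \<infinity>"
        using that by simp
    qed
    have "AE x in lebesgue. x \<noteq> (0 :: real ^ 'n)"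
      by (rule AE_completion) (rule AE_lborel_singleton)
    then show "AE x in lebesgue. set_integrable lebesgue {t. norm x \<le> norm t} (hardy_adj_kernel \<beta> f x)"
      using AE_q2(2)
    proof eventually_elim
      case (elim x)
      then have "?J x < \<infinity>"
        using kernel[OF mem_dyadic_annulus_ceiling, of x] by (auto intro: le_less_trans)
      then show ?case by (rule integrable)
    qed
    define g where "g x = (1 + norm x) powr (- \<gamma> x) * hardy_adj \<beta> f x" for x
    have weight: "(1 + norm x) powr (- \<gamma> x) \<le> 1" for x
    proof -
      have "0 \<le> \<gamma> x" using assms(7)[of x] assms(12) unfolding assms(14) by (simp add: divide_le_eq_1)
      then have "(1 + norm x) powr (- \<gamma> x) \<le> (1 + norm x) powr 0" by (intro powr_mono) auto
      then show ?thesis by (simp split: if_splits)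
    qed
    have g_le: "\<bar>g x\<bar> \<le> A * T k * norm x powr (- ?n / q2 x)"
      if x: "x \<in> dyadic_annulus k" "\<delta>2 \<le> 1 / q2 x" for x k
    proof -
      have "?J x < \<infinity>" using kernel[OF x] by (rule le_less_trans) simp
      have "ennreal \<bar>hardy_adj \<beta> f x\<bar>
          \<le> (\<integral>\<^sup>+t. ennreal (norm (indicator {t. norm x \<le> norm t} t *\<^sub>R hardy_adj_kernel \<beta> f x t)) \<partial>lebesgue)"
        using integral_norm_bound_ennreal[OF integrable[OF \<open>?J x < \<infinity>\<close>, unfolded set_integrable_def]]
        by (simp add: hardy_adj_def set_lebesgue_integral_def)
      also have "\<dots> = ?J x" by (intro nn_integral_cong) (auto simp: indicator_def)
      also note kernel[OF x]
      finally have "\<bar>hardy_adj \<beta> f x\<bar> \<le> A * T k * norm x powr (- ?n / q2 x)"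
        using A T[of k] by (subst (asm) ennreal_le_iff) auto
      moreover have "\<bar>g x\<bar> \<le> 1 * \<bar>hardy_adj \<beta> f x\<bar>"
        unfolding g_def abs_mult using weight[of x] by (intro mult_right_mono) auto
      ultimately show ?thesis by simp
    qed
    have g_norm: "var_Lebesgue_norm UNIV q2 (\<lambda>x. g x * indicator (dyadic_annulus k) x) \<le> ennreal (B * T k)" for k
    proof -
      have "AE x in lebesgue. x \<in> dyadic_annulus k \<longrightarrow> \<bar>g x\<bar> \<le> A * T k * norm x powr (- real DIM(real ^ 'n) / q2 x)"
        using AE_q2(2) by eventually_elim (use g_le in simp)
      from var_Lebesgue_norm_annulus_le[OF AE_q2(1) _ this] show ?thesis
        using A T[of k] by (simp add: B_def mult.assoc)
    qed
    have [measurable]: "hardy_adj \<beta> f \<in> borel_measurable lebesgue"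
      by (intro borel_measurable_hardy_adj f_meas assms(6))
    have [measurable]: "\<gamma> \<in> borel_measurable lebesgue"
    proof -
      have "\<gamma> = (\<lambda>x. Cinf * \<beta> x * (1 - \<beta> x / ?n))" using assms(14) by auto
      then show ?thesis using assms(6) by simp
    qed
    have g_meas: "g \<in> borel_measurable lebesgue" unfolding g_def by measurable
    have g_herz: "herz_morrey_norm \<alpha> lam p2 q2 g \<le> ennreal (B * D * M)"
    proof (rule herz_morrey_norm_leI[OF _ _ _ g_norm])
      fix F :: "int set" and m assume F: "finite F" "F \<subseteq> {..m}"
      have "(\<Sum>k\<in>F. (2 powr (real_of_int k * \<alpha>) * (B * T k)) powr p2)
          = B powr p2 * (\<Sum>k\<in>F. (2 powr (real_of_int k * \<alpha>) * T k) powr p2)"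
        using B T by (simp add: sum_distrib_left powr_mult mult_ac)
      also have "\<dots> \<le> B powr p2 * (D * M * 2 powr (real_of_int m * lam)) powr p2"
        by (intro mult_left_mono T_sums F) simp
      also have "\<dots> = (B * D * M * 2 powr (real_of_int m * lam)) powr p2"
        using B D M by (simp add: powr_mult)
      finally show "(\<Sum>k\<in>F. (2 powr (real_of_int k * \<alpha>) * (B * T k)) powr p2)
          \<le> (B * D * M * 2 powr (real_of_int m * lam)) powr p2" .
    qed (use assms B D M T in auto)
    have "g \<in> var_Lebesgue_loc (UNIV - {0}) q2"
    proof (rule var_Lebesgue_locI_annuli[OF g_meas q2_meas])
      show "AE x in lebesgue. 0 \<le> q2 x" using AE_q2(1) by eventually_elim simp
      show "var_Lebesgue_norm UNIV q2 (\<lambda>x. g x * indicator (dyadic_annulus k) x) < \<infinity>" for k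
        using g_norm[of k] by (rule le_less_trans) simp
    qed
    moreover have "herz_morrey_norm \<alpha> lam p2 q2 g < \<infinity>" using g_herz by (rule le_less_trans) simp
    ultimately show "(\<lambda>x. (1 + norm x) powr (- \<gamma> x) * hardy_adj \<beta> f x) \<in> herz_morrey \<alpha> lam p2 q2"
      unfolding herz_morrey_def g_def by simp
    show "herz_morrey_norm \<alpha> lam p2 q2 (\<lambda>x. (1 + norm x) powr (- \<gamma> x) * hardy_adj \<beta> f x)
             \<le> ennreal (B * D) * herz_morrey_norm \<alpha> lam p1 q1 f"
      using g_herz B D M unfolding g_def by (simp add: ennreal_mult)
  qed
qed

end
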